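(* Let $\varphi_1=\tfrac12\varphi$, where $\varphi$ is a Jacob's ladder, and let $\tilde Z^2(t)=\frac{d\varphi_1(t)}{dt}$. There is a constant $T_0=T_0[\varphi_1]$ such that for every $T\ge T_0$, with $\mathring{T}=\varphi_1^{-1}(T)$ and $\mathring{(T+2)}=\varphi_1^{-1}(T+2)$, the functions $U_n(\varphi_1(t)-T-1)$, $t\in[\mathring{T},\mathring{(T+2)}]$, $n=0,1,2,\dots$, where $U_n$ is the $n$-th Chebyshev polynomial of the second kind, form an orthogonal system on $[\mathring{T},\mathring{(T+2)}]$ with weight function $\sqrt{1-(\varphi_1(t)-T-1)^2}\,\tilde Z^2(t)$; that is, for all $m,n\in\{0,1,2,\dots\}$, $$\int_{\mathring{T}}^{\mathring{(T+2)}}U_m(\varphi_1(t)-T-1)\,U_n(\varphi_1(t)-T-1)\,\sqrt{1-(\varphi_1(t)-T-1)^2}\,\tilde Z^2(t)\,dt=0\quad(m\neq n),$$ $$\int_{\mathring{T}}^{\mathring{(T+2)}}\left[U_n(\varphi_1(t)-T-1)\right]^2\sqrt{1-(\varphi_1(t)-T-1)^2}\,\tilde Z^2(t)\,dt=\frac{\pi}{2}.$$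
   Context: Hardy's function: $Z(t)=e^{i\vartheta(t)}\zeta(\tfrac12+it)$ with $\vartheta(t)=-\tfrac t2\ln\pi+\operatorname{Im}\ln\Gamma(\tfrac14+i\tfrac t2)$, where $\zeta$ is the Riemann zeta-function; thus $Z$ is real-valued and $Z^2(t)=|\zeta(\tfrac12+it)|^2$. Jacob's ladder: fix an infinitely differentiable, increasing, unbounded function $\mu:[y_0,\infty)\to\mathbb{R}$ with $\mu(y)\ge 7y\ln y$. The Jacob's ladder $\varphi$ (associated with $\mu$) is the solution $X(T)=\varphi(T)$, defined for all sufficiently large $T$, of the nonlinear integral equation $$\int_0^{\mu[X(T)]}Z^2(t)e^{-\frac{2}{X(T)}t}\,dt=\int_0^T Z^2(t)\,dt .$$ Put $\varphi_1(t)=\tfrac12\varphi(t)$. For large $t$ the function $\varphi_1$ is continuously differentiable, strictly increasing and unbounded, so it has an inverse $\varphi_1^{-1}$ on a half-line; its derivative is denoted $\tilde Z^2(t)=\frac{d\varphi_1(t)}{dt}$. With $\Phi(y)=\int_0^{\mu(y)}Z^2(t)e^{-2t/y}\,dt$ one has $\tilde Z^2(t)=\frac{Z^2(t)}{2\Phi'(\varphi(t))}$. The Chebyshev polynomial of the second kind $U_n$ is given by $U_n(\cos\theta)=\frac{\sin((n+1)\theta)}{\sin\theta}$. *)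

theory Defs
  imports "HOL-Complex_Analysis.Complex_Analysis"
begin

(* Analytic continuation of the Dirichlet series to the plane without the pole at 1.
   Such a function exists and, by the identity theorem, is unique off 1;
   the value at 1 is unspecified. *)
definition riemann_zeta :: "complex \<Rightarrow> complex" where
  "riemann_zeta = (SOME f. f holomorphic_on (- {1}) \<and>
     (\<forall>s. Re s > 1 \<longrightarrow> (\<lambda>n. of_nat (Suc n) powr (- s)) sums f s))"

(* ln_Gamma is the branch of the logarithm of Gamma that is holomorphic off the
   nonpositive real axis and real on the positive reals (not Ln composed with Gamma). *)
definition hardy_theta :: "real \<Rightarrow> real" where
  "hardy_theta t = - (t / 2) * ln pi + Im (ln_Gamma (Complex (1 / 4) (t / 2)))"

(* The values are real numbers, here as elements of the complex plane; hence the
   square of Z is written (cmod (hardy_Z t))^2 below. *)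
definition hardy_Z :: "real \<Rightarrow> complex" where
  "hardy_Z t = exp (\<i> * of_real (hardy_theta t)) * riemann_zeta (Complex (1 / 2) t)"

(* All derivatives on [a, \<infinity>), one-sided at a. *)
definition smooth_on_atLeast :: "real \<Rightarrow> (real \<Rightarrow> real) \<Rightarrow> bool" where
  "smooth_on_atLeast a f \<longleftrightarrow>
     (\<exists>D :: nat \<Rightarrow> real \<Rightarrow> real. (\<forall>y\<ge>a. D 0 y = f y) \<and>
        (\<forall>k. \<forall>y\<ge>a. (D k has_real_derivative D (Suc k) y) (at y within {a..})))"

(* y0 > 0 is what makes y ln y meaningful on [y0, \<infinity>). *)
definition admissible_mu :: "real \<Rightarrow> (real \<Rightarrow> real) \<Rightarrow> bool" where
  "admissible_mu y0 \<mu> \<longleftrightarrow> y0 > 0 \<and> smooth_on_atLeast y0 \<mu> \<and> mono_on {y0..} \<mu> \<and>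
     \<not> bdd_above (\<mu> ` {y0..}) \<and> (\<forall>y\<ge>y0. \<mu> y \<ge> 7 * y * ln y)"

definition jacobs_ladder :: "real \<Rightarrow> (real \<Rightarrow> real) \<Rightarrow> (real \<Rightarrow> real) \<Rightarrow> bool" where
  "jacobs_ladder y0 \<mu> \<phi> \<longleftrightarrow>
     (\<forall>\<^sub>F T in at_top. \<phi> T \<ge> y0 \<and>
        integral {0..\<mu> (\<phi> T)} (\<lambda>t. (cmod (hardy_Z t))\<^sup>2 * exp (- (2 / \<phi> T) * t)) =
        integral {0..T} (\<lambda>t. (cmod (hardy_Z t))\<^sup>2))"

definition chebyshev_U :: "nat \<Rightarrow> real poly" where
  "chebyshev_U n = (THE p. \<forall>\<theta>. sin \<theta> \<noteq> 0 \<longrightarrow> poly p (cos \<theta>) = sin (real (n + 1) * \<theta>) / sin \<theta>)"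

lemma chebyshev_U_exists:
  "\<exists>p :: real poly. \<forall>\<theta>. sin \<theta> \<noteq> 0 \<longrightarrow> poly p (cos \<theta>) = sin (real (n + 1) * \<theta>) / sin \<theta>"
proof (induction n rule: induct_nat_012)
  case 0
  show ?case by (rule exI[of _ 1]) simp
next
  case 1
  show ?case by (rule exI[of _ "[:0, 2:]"]) (simp add: sin_double)
next
  case (ge2 n)
  then obtain p q :: "real poly" where
    p: "\<And>\<theta>. sin \<theta> \<noteq> 0 \<Longrightarrow> poly p (cos \<theta>) = sin (real (n + 1) * \<theta>) / sin \<theta>" and
    q: "\<And>\<theta>. sin \<theta> \<noteq> 0 \<Longrightarrow> poly q (cos \<theta>) = sin (real (Suc n + 1) * \<theta>) / sin \<theta>"
    by blast
  have step: "sin (real (Suc (Suc n) + 1) * \<theta>) =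
      2 * cos \<theta> * sin (real (Suc n + 1) * \<theta>) - sin (real (n + 1) * \<theta>)" for \<theta>
    using sin_add[of "real (Suc n + 1) * \<theta>" \<theta>] sin_diff[of "real (Suc n + 1) * \<theta>" \<theta>]
    by (simp add: algebra_simps)
  show ?case
  proof (intro exI[of _ "[:0, 2:] * q - p"] allI impI)
    fix \<theta> :: real assume "sin \<theta> \<noteq> 0"
    then show "poly ([:0, 2:] * q - p) (cos \<theta>) = sin (real (Suc (Suc n) + 1) * \<theta>) / sin \<theta>"
      unfolding step by (simp add: p q diff_divide_distrib mult.assoc del: of_nat_Suc of_nat_add add_Suc_right Suc_eq_plus1 add_2_eq_Suc')
  qed
qed

lemma chebyshev_U_unique:
  fixes p q :: "real poly"
  assumes "\<And>\<theta>. sin \<theta> \<noteq> 0 \<Longrightarrow> poly p (cos \<theta>) = poly q (cos \<theta>)"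
  shows "p = q"
proof (rule ccontr)
  assume "p \<noteq> q"
  then have fin: "finite {x. poly (p - q) x = 0}"
    by (intro poly_roots_finite) simp
  have "{-1<..<1} \<subseteq> {x. poly (p - q) x = 0}"
  proof
    fix x :: real assume x: "x \<in> {-1<..<1}"
    then have "x\<^sup>2 < 1" by (auto simp: abs_square_less_1)
    with x have "cos (arccos x) = x" "sin (arccos x) \<noteq> 0"
      by (auto simp: cos_arccos sin_arccos)
    with assms[of "arccos x"] show "x \<in> {x. poly (p - q) x = 0}" by simp
  qed
  with fin have "finite {-1<..<1::real}" by (rule finite_subset[rotated])
  then show False using infinite_Ioo[of "-1" "1 :: real"] by simp
qed

lemma poly_chebyshev_U_cos:
  assumes "sin \<theta> \<noteq> 0"
  shows "poly (chebyshev_U n) (cos \<theta>) = sin (real (n + 1) * \<theta>) / sin \<theta>"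
proof -
  have "\<exists>!p :: real poly. \<forall>\<theta>. sin \<theta> \<noteq> 0 \<longrightarrow> poly p (cos \<theta>) = sin (real (n + 1) * \<theta>) / sin \<theta>"
    using chebyshev_U_exists[of n] by (auto intro!: chebyshev_U_unique)
  from theI'[OF this] assms show ?thesis unfolding chebyshev_U_def by blast
qed

end

theory Submission
  imports Defs
begin

text \<open>Put \<open>W T = \<integral>\<^sub>0\<^sup>T Z\<^sup>2\<close>. Wherever \<open>\<mu> y > 0\<close>, the function \<open>\<Phi>\<close> is continuously differentiable with
positive derivative (Leibniz rule; \<open>Z\<close> has no interval of zeros), so a Jacob's ladder is \<open>\<Phi>\<^sup>-\<^sup>1 \<circ> W\<close> and
is \<open>C\<^sup>1\<close> and strictly increasing. It is unbounded because \<open>W\<close> is, which comes from the mean square of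
\<open>\<eta> s = (1 - 2 powr (1 - s)) * \<zeta> s\<close>: on \<open>[T, 2T]\<close> the alternating Dirichlet sum of length of order \<open>T\<^sup>2\<close>
approximates \<open>\<eta>\<close> up to a small constant, and all of its terms but the first oscillate. The substitution
\<open>x = \<phi>1 t - T - 1\<close> then reduces the claim to the orthogonality of the Chebyshev polynomials on \<open>[-1, 1]\<close>.\<close>

subsection \<open>Analytic continuation of the zeta function\<close>

text \<open>\<open>riemann_zeta\<close> is picked by \<open>SOME\<close>, so nothing can be said
  about it until a continuation has been built. The crux after that is the unboundedness of W: with
  W bounded the ladder need not reach T at all. It is obtained from a first moment. Integrating eta
  itself over [T, 2T] produces no off-diagonal terms: the term n = 1 contributes T, and
  \<open>x \<le> x^2 + 1/4\<close> passes from the mean of |eta| to its mean square. The tail after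
  K pairs is only bounded by a multiple of |s| / sqrt K, which forces a length of order T^2. At that
  length a bound n powr (-1/2) for the integrals of the other terms would add up to order T, as
  large as the main term; the factor 1 / ln n gained by oscillation is what makes their sum a small
  multiple of T. The passage back to zeta is cheap because the factor
  \<open>1 - 2 powr (1 - s)\<close> is bounded on the critical line. The same unboundedness shows
  that zeta is not identically zero, which by the identity theorem excludes intervals of zeros of
  Z.\<close>

lemma powr_add_one_taylor:
  fixes a :: complex and n :: nat
  assumes n: "n \<ge> 1" and a: "Re a \<le> real K + 1"
  shows "cmod (of_nat (Suc n) powr a - (\<Sum>k\<le>K. (a gchoose k) * of_nat n powr (a - of_nat k)))
           \<le> cmod (\<Prod>i\<le>K. a - of_nat i) / fact K * real n powr (Re a - real K - 1)"
proof -
  \<comment> \<open>\<open>f i\<close> is the i-th derivative of \<open>z powr a\<close>. The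
    hypothesis on \<open>Re a\<close> makes the exponent in derivative \<open>Suc K\<close>
    nonpositive, so its modulus on the segment is largest at the left end \<open>n\<close>.\<close>
  define f where "f = (\<lambda>i (z::complex). (\<Prod>j<i. a - of_nat j) * z powr (a - of_nat i))"
  define S where "S = closed_segment (of_nat n :: complex) (of_nat (Suc n))"
  have S: "\<exists>x. z = of_real x \<and> x \<ge> real n" if zS: "z \<in> S" for z
  proof -
    obtain u where "u \<ge> 0" "z = (1 - u) *\<^sub>R of_nat n + u *\<^sub>R of_nat (Suc n)"
      using zS by (auto simp: S_def in_segment)
    then have "u \<ge> 0" "z = of_real (real n + u)"
      by (simp_all add: scaleR_conv_of_real algebra_simps)
    then show ?thesis by (intro exI[of _ "real n + u"]) auto
  qed
  have B: "cmod (f (Suc K) z) \<le> cmod (\<Prod>i\<le>K. a - of_nat i) * real n powr (Re a - real K - 1)"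
    if zS: "z \<in> S" for z
  proof -
    obtain x where x: "z = of_real x" "x \<ge> real n" using S[OF zS] by blast
    have "cmod (z powr (a - of_nat (Suc K))) = x powr (Re a - real K - 1)"
      using x n by (subst norm_powr_real_powr) (auto simp: algebra_simps)
    also have "\<dots> \<le> real n powr (Re a - real K - 1)"
      using x n a by (intro powr_mono2') auto
    finally show ?thesis
      by (simp add: f_def norm_mult lessThan_Suc_atMost mult_left_mono)
  qed
  have "cmod (f 0 (of_nat (Suc n)) - (\<Sum>i\<le>K. f i (of_nat n) * (of_nat (Suc n) - of_nat n) ^ i / fact i))
     \<le> cmod (\<Prod>i\<le>K. a - of_nat i) * real n powr (Re a - real K - 1)
        * cmod (of_nat (Suc n) - of_nat n) ^ (Suc K) / fact K"
  proof (rule complex_Taylor[where S = S])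
    show "convex S" by (simp add: S_def)
    fix i z assume z: "z \<in> S"
    obtain x where x: "z = of_real x" "x \<ge> real n" using S[OF z] by blast
    then have "z \<notin> \<real>\<^sub>\<le>\<^sub>0" using n by auto
    then show "(f i has_field_derivative f (Suc i) z) (at z within S)"
      unfolding f_def by (auto intro!: derivative_eq_intros simp: algebra_simps)
  qed (use B in \<open>auto simp: S_def\<close>)
  moreover have "f i (of_nat n) / fact i = (a gchoose i) * of_nat n powr (a - of_nat i)" for i
    by (simp add: f_def gbinomial_prod_rev atLeast0LessThan)
  ultimately show ?thesis by (simp add: f_def)
qed

text \<open>The Weierstrass test with a local real majorant. The comparison theorem behind it wants
  a complex majorant with nonnegative real values, hence the coercion of \<open>h\<close>; its
  nonnegativity is automatic, as it dominates a norm.\<close>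

lemma sums_holomorphic_on:
  fixes f :: "nat \<Rightarrow> complex \<Rightarrow> complex"
  assumes S: "open S" and f: "\<And>n. f n holomorphic_on S"
    and bnd: "\<And>z. z \<in> S \<Longrightarrow> \<exists>d>0. \<exists>h. summable h \<and>
      (\<forall>n. \<forall>w \<in> ball z d \<inter> S. cmod (f n w) \<le> h n)"
  obtains g where "g holomorphic_on S" "\<And>z. z \<in> S \<Longrightarrow> (\<lambda>n. f n z) sums g z"
proof -
  have "\<exists>d h. d > 0 \<and> summable h \<and> range h \<subseteq> \<real>\<^sub>\<ge>\<^sub>0 \<and>
      (\<forall>\<^sub>F n in sequentially. \<forall>w\<in>ball z d \<inter> S. cmod (f n w) \<le> cmod (h n))" if z: "z \<in> S" for z
  proof -
    obtain d h where d: "d > 0" and h: "summable h" "\<And>n w. w \<in> ball z d \<inter> S \<Longrightarrow> cmod (f n w) \<le> h n"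
      using bnd[OF z] by metis
    have "h n \<ge> 0" for n using h(2)[of z n] z d order_trans[OF norm_ge_zero] by auto
    then show ?thesis using d h
      by (intro exI[of _ d] exI[of _ "\<lambda>n. complex_of_real (h n)"])
         (auto simp: summable_of_real)
  qed
  then have bnd': "\<And>z. z \<in> S \<Longrightarrow> \<exists>d h. 0 < d \<and> summable h \<and> range h \<subseteq> \<real>\<^sub>\<ge>\<^sub>0 \<and>
      (\<forall>\<^sub>F n in sequentially. \<forall>w\<in>ball z d \<inter> S. cmod (f n w) \<le> cmod (h n))"
    by blast
  have diff: "\<And>n z. z \<in> S \<Longrightarrow> f n field_differentiable (at z)"
    using f S holomorphic_on_imp_differentiable_at by blast
  obtain g where g: "\<forall>z\<in>S. (\<lambda>n. f n z) sums g z \<and> g field_differentiable (at z)"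
    using series_differentiable_comparison_complex[OF S diff bnd'] by blast
  then have "g holomorphic_on S"
    using S by (auto simp: holomorphic_on_def field_differentiable_at_within)
  with g show ?thesis using that by blast
qed

text \<open>For the exponent \<open>1 - s\<close> the Taylor remainder of order \<open>K\<close> is
  of size n powr (- Re s - K), summable exactly for \<open>Re s > 1 - K\<close>. Half the distance
  to the boundary line is the radius \<open>d\<close> that makes this locally uniform.\<close>

lemma holomorphic_sum_powr_taylor_remainder:
  obtains G where "G holomorphic_on {s. Re s > 1 - real K}"
    "\<And>s. Re s > 1 - real K \<Longrightarrow>
      (\<lambda>n. of_nat (Suc (Suc n)) powr (1 - s)
         - (\<Sum>k\<le>K. ((1 - s) gchoose k) * of_nat (Suc n) powr (1 - s - of_nat k))) sums G s"
proof -
  let ?S = "{s. Re s > 1 - real K}"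
  define f where "f = (\<lambda>n (s::complex). of_nat (Suc (Suc n)) powr (1 - s)
         - (\<Sum>k\<le>K. ((1 - s) gchoose k) * of_nat (Suc n) powr (1 - s - of_nat k)))"
  have holo: "f n holomorphic_on ?S" for n
    unfolding f_def gbinomial_prod_rev
    by (intro holomorphic_intros) (auto simp del: of_nat_Suc)
  have bnd: "\<exists>d>0. \<exists>h. summable h \<and> (\<forall>n. \<forall>w \<in> ball z d \<inter> ?S. cmod (f n w) \<le> h n)" if z: "z \<in> ?S" for z
  proof -
    define d where "d = (Re z - (1 - real K)) / 2"
    have d: "d > 0" using z by (simp add: d_def)
    have "compact ((\<lambda>w. \<Prod>i\<le>K. 1 - w - of_nat i) ` cball z d)"
      by (intro compact_continuous_image continuous_intros) auto
    then obtain C0 where C0: "\<And>w. w \<in> cball z d \<Longrightarrow> cmod (\<Prod>i\<le>K. 1 - w - of_nat i) \<le> C0"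
      by (meson bounded_iff compact_imp_bounded imageI)
    define C where "C = max C0 0"
    have C: "C \<ge> 0" "\<And>w. w \<in> cball z d \<Longrightarrow> cmod (\<Prod>i\<le>K. 1 - w - of_nat i) \<le> C"
      using C0 by (force simp: C_def)+
    define h where "h = (\<lambda>n. C / fact K * real (Suc n) powr (-(1 + d)))"
    have "summable (\<lambda>n. real (Suc n) powr (-(1 + d)))"
      using d by (subst summable_Suc_iff) (simp add: summable_real_powr_iff)
    then have "summable h" unfolding h_def by (rule summable_mult)
    moreover have "cmod (f n w) \<le> h n" if w: "w \<in> ball z d \<inter> ?S" for n w
    proof -
      have "Re z - Re w < d"
        using w complex_Re_le_cmod[of "z - w"] by (auto simp: dist_norm)
      then have Re: "Re w \<ge> 1 - real K + d" by (auto simp: d_def field_simps)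
      have "cmod (f n w) \<le> cmod (\<Prod>i\<le>K. 1 - w - of_nat i) / fact K * real (Suc n) powr (Re (1 - w) - real K - 1)"
        unfolding f_def by (rule powr_add_one_taylor) (use Re d in auto)
      also have "\<dots> \<le> h n"
        unfolding h_def using C(1) C(2)[of w] w Re
        by (intro mult_mono divide_right_mono powr_mono) auto
      finally show ?thesis .
    qed
    ultimately show ?thesis using d by blast
  qed
  have "open ?S" by (simp add: open_halfspace_Re_gt)
  from sums_holomorphic_on[OF this holo bnd] obtain g where
    "g holomorphic_on ?S" "\<And>z. z \<in> ?S \<Longrightarrow> (\<lambda>n. f n z) sums g z" by blast
  with that[of g] show ?thesis by (simp add: f_def)
qed

lemma holomorphic_zeta_series:
  obtains Z where "Z holomorphic_on {s. Re s > 1}"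
    "\<And>s. Re s > 1 \<Longrightarrow> (\<lambda>n. of_nat (Suc n) powr (- s)) sums Z s"
proof -
  let ?S = "{s. Re s > 1}"
  let ?f = "\<lambda>n s :: complex. of_nat (Suc n) powr (- s)"
  have holo: "?f n holomorphic_on ?S" for n
    by (intro holomorphic_intros) (auto simp del: of_nat_Suc)
  have bnd: "\<exists>d>0. \<exists>h. summable h \<and> (\<forall>n. \<forall>w \<in> ball z d \<inter> ?S. cmod (?f n w) \<le> h n)" if z: "z \<in> ?S" for z
  proof -
    define d where "d = (Re z - 1) / 2"
    have d: "d > 0" using z by (simp add: d_def)
    have "summable (\<lambda>n. real (Suc n) powr (-(1 + d)))"
      using d by (subst summable_Suc_iff) (simp add: summable_real_powr_iff)
    moreover have "cmod (?f n w) \<le> real (Suc n) powr (-(1 + d))" if w: "w \<in> ball z d \<inter> ?S" for n w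
    proof -
      have "Re z - Re w < d"
        using w complex_Re_le_cmod[of "z - w"] by (auto simp: dist_norm)
      then have "Re w \<ge> 1 + d" by (auto simp: d_def field_simps)
      then show ?thesis by (subst norm_powr_real_powr) (auto intro!: powr_mono)
    qed
    ultimately show ?thesis using d by blast
  qed
  have "open ?S" by (simp add: open_halfspace_Re_gt)
  from sums_holomorphic_on[OF this holo bnd] obtain g where
    "g holomorphic_on ?S" "\<And>z. z \<in> ?S \<Longrightarrow> (\<lambda>n. ?f n z) sums g z" by blast
  with that[of g] show ?thesis by simp
qed

text \<open>Summing the Taylor expansion of \<open>(n + 1) powr (1 - s) - n powr (1 - s)\<close> over \<open>n\<close> telescopes on the left
and expresses \<open>E s = (s - 1) * \<zeta> s\<close> through the values \<open>E (s + 1), E (s + 2), \<dots>\<close> and a remainder that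
is holomorphic further to the left. The factor \<open>s + k - 2\<close> of \<open>(1 - s) gchoose k\<close> cancels the pole of \<open>\<zeta> (s + k - 1)\<close>.\<close>
lemma zeta_continuation_step:
  assumes E: "E holomorphic_on {s. Re s > 1 - real M}"
    and E_sums: "\<And>s. Re s > 1 \<Longrightarrow> (\<lambda>n. of_nat (Suc n) powr (- s)) sums (E s / (s - 1))"
  obtains E' where "E' holomorphic_on {s. Re s > 1 - real (Suc M)}"
    "\<And>s. Re s > 1 \<Longrightarrow> (\<lambda>n. of_nat (Suc n) powr (- s)) sums (E' s / (s - 1))"
proof -
  define K where "K = Suc M"
  let ?S = "{s. Re s > 1 - real K}"
  obtain G where G: "G holomorphic_on ?S"
    and G_sums: "\<And>s. Re s > 1 - real K \<Longrightarrow>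
      (\<lambda>n. of_nat (Suc (Suc n)) powr (1 - s)
         - (\<Sum>k\<le>K. ((1 - s) gchoose k) * of_nat (Suc n) powr (1 - s - of_nat k))) sums G s"
    using holomorphic_sum_powr_taylor_remainder[of K] by blast
  define d where "d = (\<lambda>k (s::complex). - (\<Prod>i<k - 1. 1 - s - of_nat i) / fact k)"
  define E' where "E' = (\<lambda>s. 1 + (\<Sum>k=2..K. d k s * E (s + of_nat (k - 1))) + G s)"
  \<comment> \<open>Since \<open>k \<ge> 2\<close>, the argument is shifted right by at least 1;
    this is how each step gains a strip of width 1.\<close>
  have "(E \<circ> (\<lambda>s. s + of_nat (k - 1))) holomorphic_on ?S" if "k \<in> {2..K}" for k
    using that by (intro holomorphic_on_compose_gen[OF _ E] holomorphic_intros) (auto simp: K_def)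
  then have "E' holomorphic_on ?S"
    unfolding E'_def d_def by (intro holomorphic_intros G) (auto simp: o_def)
  moreover have "(\<lambda>n. of_nat (Suc n) powr (- s)) sums (E' s / (s - 1))" if s: "Re s > 1" for s
  proof -
    define a where "a = 1 - s"
    define z where "z = (\<lambda>s. E s / (s - 1))"
    have "(\<lambda>n. complex_of_nat (Suc n) powr a) \<longlonglongrightarrow> 0"
    proof (rule tendsto_norm_zero_cancel)
      have "(\<lambda>n. real (Suc n) powr Re a) \<longlonglongrightarrow> 0"
        using s by (intro tendsto_neg_powr filterlim_compose[OF filterlim_real_sequentially filterlim_Suc])
                   (auto simp: a_def)
      then show "(\<lambda>n. cmod (complex_of_nat (Suc n) powr a)) \<longlonglongrightarrow> 0"
        by (subst norm_powr_real_powr) auto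
    qed
    from telescope_sums[OF this]
    have 1: "(\<lambda>n. of_nat (Suc (Suc n)) powr a - of_nat (Suc n) powr a) sums (- 1)"
      by simp
    have "(\<lambda>n. (a gchoose k) * of_nat (Suc n) powr (a - of_nat k)) sums ((a gchoose k) * z (s + of_nat (k - 1)))"
      if "k \<in> {1..K}" for k
    proof -
      have "a - of_nat k = - (s + of_nat (k - 1))" using that by (simp add: a_def of_nat_diff)
      then show ?thesis using E_sums[of "s + of_nat (k - 1)"] s
        unfolding z_def by (intro sums_mult) simp
    qed
    then have "(\<lambda>n. \<Sum>k=1..K. (a gchoose k) * of_nat (Suc n) powr (a - of_nat k))
        sums (\<Sum>k=1..K. (a gchoose k) * z (s + of_nat (k - 1)))"
      by (rule sums_sum)
    from sums_diff[OF 1 this]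
    have "(\<lambda>n. of_nat (Suc (Suc n)) powr a - of_nat (Suc n) powr a
          - (\<Sum>k=1..K. (a gchoose k) * of_nat (Suc n) powr (a - of_nat k)))
        sums (- 1 - (\<Sum>k=1..K. (a gchoose k) * z (s + of_nat (k - 1))))" .
    moreover have "of_nat (Suc (Suc n)) powr a - of_nat (Suc n) powr a
          - (\<Sum>k=1..K. (a gchoose k) * of_nat (Suc n) powr (a - of_nat k))
       = of_nat (Suc (Suc n)) powr (1 - s)
         - (\<Sum>k\<le>K. ((1 - s) gchoose k) * of_nat (Suc n) powr (1 - s - of_nat k))" for n
      by (simp add: a_def atMost_atLeast0 sum.atLeast_Suc_atMost[of 0])
    ultimately have "G s = - 1 - (\<Sum>k=1..K. (a gchoose k) * z (s + of_nat (k - 1)))"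
      using G_sums[of s] s by (simp add: sums_iff K_def)
    \<comment> \<open>The term \<open>k = 1\<close> is (1 - s) times zeta, minus the unknown; the
      identity is solved for it.\<close>
    also have "(\<Sum>k=1..K. (a gchoose k) * z (s + of_nat (k - 1)))
       = a * z s + (\<Sum>k=2..K. (a gchoose k) * z (s + of_nat (k - 1)))"
      using sum.atLeast_Suc_atMost[of 1 K "\<lambda>k. (a gchoose k) * z (s + of_nat (k - 1))"]
      by (simp add: K_def numeral_2_eq_2)
    also have "(\<Sum>k=2..K. (a gchoose k) * z (s + of_nat (k - 1))) = (\<Sum>k=2..K. d k s * E (s + of_nat (k - 1)))"
    proof (rule sum.cong)
      fix k assume k: "k \<in> {2..K}"
      then obtain l where l: "k = Suc (Suc l)" by (auto simp: le_iff_add)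
      have nz: "s + of_nat (Suc l) - 1 \<noteq> 0"
      proof
        assume "s + of_nat (Suc l) - 1 = 0"
        then have "Re (s + of_nat (Suc l) - 1) = 0" by simp
        then show False using s by simp
      qed
      have "(a gchoose k) = d k s * (s + of_nat (k - 1) - 1)"
      proof -
        have "(\<Prod>i<k. a - of_nat i) = (\<Prod>i<k - 1. a - of_nat i) * (a - of_nat (k - 1))"
          by (simp add: l)
        also have "a - of_nat (k - 1) = - (s + of_nat (k - 1) - 1)"
          by (simp add: a_def)
        finally have eq: "(\<Prod>i<k. a - of_nat i)
          = (\<Prod>i<k - 1. a - of_nat i) * - (s + of_nat (k - 1) - 1)" .
        have aux: "x * - y / c = - x / c * y" for x y c :: complex
          by simp
        show ?thesis
          unfolding gbinomial_prod_rev atLeast0LessThan eq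
          unfolding d_def a_def by (rule aux)
      qed
      then show "(a gchoose k) * z (s + of_nat (k - 1)) = d k s * E (s + of_nat (k - 1))"
        using nz by (simp add: z_def l)
    qed simp
    finally have "E' s = - a * z s" by (simp add: E'_def)
    moreover have "s - 1 \<noteq> 0" using s by auto
    ultimately have eq: "E' s / (s - 1) = z s" by (simp add: a_def field_simps)
    show ?thesis unfolding eq unfolding z_def by (rule E_sums[OF s])
  qed
  ultimately show ?thesis using that[of E'] by (simp add: K_def)
qed

lemma zeta_continuation_halfplane:
  "\<exists>E. E holomorphic_on {s. Re s > 1 - real M} \<and>
     (\<forall>s. Re s > 1 \<longrightarrow> (\<lambda>n. of_nat (Suc n) powr (- s)) sums (E s / (s - 1)))"
proof (induction M)
  case 0
  obtain Z where "Z holomorphic_on {s. Re s > 1}"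
    "\<And>s. Re s > 1 \<Longrightarrow> (\<lambda>n. of_nat (Suc n) powr (- s)) sums Z s"
    using holomorphic_zeta_series by blast
  then show ?case
    by (intro exI[of _ "\<lambda>s. (s - 1) * Z s"]) (auto intro!: holomorphic_intros)
next
  case (Suc M)
  then obtain E where E: "E holomorphic_on {s. Re s > 1 - real M}" and E_sums:
    "\<And>s. Re s > 1 \<Longrightarrow> (\<lambda>n. of_nat (Suc n) powr (- s)) sums (E s / (s - 1))" by blast
  obtain E' where "E' holomorphic_on {s. Re s > 1 - real (Suc M)}"
    "\<And>s. Re s > 1 \<Longrightarrow> (\<lambda>n. of_nat (Suc n) powr (- s)) sums (E' s / (s - 1))"
    using zeta_continuation_step[OF E E_sums] by blast
  then show ?case by (intro exI[of _ E']) simp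
qed

text \<open>This makes the choice in the definition of \<^const>\<open>riemann_zeta\<close> meaningful.\<close>
lemma riemann_zeta_exists:
  "\<exists>f. f holomorphic_on (- {1}) \<and> (\<forall>s. Re s > 1 \<longrightarrow> (\<lambda>n. of_nat (Suc n) powr (- s)) sums f s)"
proof -
  have "\<forall>M. \<exists>E. E holomorphic_on {s. Re s > 1 - real M} \<and>
     (\<forall>s. Re s > 1 \<longrightarrow> (\<lambda>n. of_nat (Suc n) powr (- s)) sums (E s / (s - 1)))"
    using zeta_continuation_halfplane by blast
  from choice[OF this] obtain E where E: "\<And>M. E M holomorphic_on {s. Re s > 1 - real M}"
    and sums: "\<And>M s. Re s > 1 \<Longrightarrow> (\<lambda>n. of_nat (Suc n) powr (- s)) sums (E M s / (s - 1))"
    by auto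
  have eq: "E M s = E N s" if "M \<le> N" "Re s > 1 - real M" for M N s
  proof (rule analytic_continuation_open[where f = "E M" and g = "E N" and s = "{s. Re s > 1}" and s' = "{s. Re s > 1 - real M}"])
    show "{s. Re s > 1} \<noteq> {}" by (auto intro!: exI[of _ 2])
    show "E N holomorphic_on {s. Re s > 1 - real M}"
      by (rule holomorphic_on_subset[OF E]) (use that in auto)
    fix w assume w: "w \<in> {s. Re s > 1}"
    show "E M w = E N w"
    proof -
      have "E M w / (w - 1) = E N w / (w - 1)" "w \<noteq> 1"
        using w sums[of w M] sums[of w N] by (auto simp: sums_iff)
      then show ?thesis by simp
    qed
  qed (use that E in \<open>auto simp: open_halfspace_Re_gt intro!: convex_connected convex_halfspace_Re_gt\<close>)
  \<comment> \<open>The half-planes exhaust the plane; \<open>m s\<close> is an index whose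
    half-plane contains \<open>s\<close>, and \<open>eq\<close> makes the glued value independent of
    this choice.\<close>
  define m where "m = (\<lambda>s. nat \<lceil>2 - Re s\<rceil>)"
  have m: "Re s > 1 - real (m s)" for s by (simp add: m_def) linarith
  define F where "F = (\<lambda>s. E (m s) s)"
  have F: "F s = E M s" if "Re s > 1 - real M" for M s
  proof (cases "M \<le> m s")
    case True
    show ?thesis unfolding F_def by (rule eq[OF True that, symmetric])
  next
    case False
    then show ?thesis unfolding F_def by (intro eq m) simp
  qed
  have "F field_differentiable (at s)" for s
  proof -
    let ?S = "{z. Re z > 1 - real (m s)}"
    have "F holomorphic_on ?S"
      using E[of "m s"] by (rule holomorphic_transform) (simp add: F)
    then show ?thesis
      using m[of s] by (intro holomorphic_on_imp_differentiable_at[of _ ?S]) (auto simp: open_halfspace_Re_gt)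
  qed
  then have "F holomorphic_on - {1}"
    by (simp add: holomorphic_on_def field_differentiable_at_within)
  moreover have "(\<lambda>n. of_nat (Suc n) powr (- s)) sums (F s / (s - 1))" if "Re s > 1" for s
    using sums[OF that, of 0] F[of 0 s] that by simp
  ultimately show ?thesis
    by (intro exI[of _ "\<lambda>s. F s / (s - 1)"]) (auto intro!: holomorphic_intros)
qed

lemma holomorphic_riemann_zeta: "riemann_zeta holomorphic_on - {1}"
  and riemann_zeta_sums: "Re s > 1 \<Longrightarrow> (\<lambda>n. of_nat (Suc n) powr (- s)) sums riemann_zeta s"
  using someI_ex[OF riemann_zeta_exists] unfolding riemann_zeta_def[symmetric] by auto

subsection \<open>The mean square of zeta on the critical line\<close>

text \<open>Two consecutive terms of the alternating series of n powr (-s). Pairing gains a factor 1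
  / n, so the paired series converges absolutely on the whole half-plane
  \<open>Re s > 0\<close>.\<close>

definition eta_term :: "nat \<Rightarrow> complex \<Rightarrow> complex" where
  "eta_term k s = of_nat (2 * k + 1) powr (- s) - of_nat (2 * k + 2) powr (- s)"

lemma cmod_eta_term_le:
  assumes "Re s > 0"
  shows "cmod (eta_term k s) \<le> cmod s * real (2 * k + 1) powr (- Re s - 1)"
proof -
  have "cmod (of_nat (Suc (2 * k + 1)) powr (- s) - (\<Sum>j\<le>0. ((- s) gchoose j) * of_nat (2 * k + 1) powr (- s - of_nat j)))
     \<le> cmod (\<Prod>i\<le>0. - s - of_nat i) / fact 0 * real (2 * k + 1) powr (Re (- s) - real 0 - 1)"
    by (rule powr_add_one_taylor) (use assms in auto)
  then show ?thesis
    unfolding eta_term_def by (subst norm_minus_commute) (simp add: add_ac)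
qed

lemma holomorphic_eta:
  obtains H where "H holomorphic_on {s. Re s > 0}" "\<And>s. Re s > 0 \<Longrightarrow> (\<lambda>k. eta_term k s) sums H s"
proof -
  let ?S = "{s. Re s > 0}"
  have holo: "eta_term k holomorphic_on ?S" for k
    unfolding eta_term_def
    by (intro holomorphic_intros) (auto simp del: of_nat_Suc of_nat_add)
  have bnd: "\<exists>d>0. \<exists>h. summable h \<and> (\<forall>k. \<forall>w \<in> ball z d \<inter> ?S. cmod (eta_term k w) \<le> h k)" if z: "z \<in> ?S" for z
  proof -
    define d where "d = Re z / 2"
    have d: "d > 0" using z by (simp add: d_def)
    define h where "h = (\<lambda>k. (cmod z + d) * real (Suc k) powr (-(1 + d)))"
    have "summable (\<lambda>n. real (Suc n) powr (-(1 + d)))"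
      using d by (subst summable_Suc_iff) (simp add: summable_real_powr_iff)
    then have "summable h" unfolding h_def by (rule summable_mult)
    moreover have "cmod (eta_term k w) \<le> h k" if w: "w \<in> ball z d \<inter> ?S" for k w
    proof -
      have "Re z - Re w < d"
        using w complex_Re_le_cmod[of "z - w"] by (auto simp: dist_norm)
      then have Re: "Re w \<ge> d" by (auto simp: d_def field_simps)
      have "cmod w \<le> cmod z + d"
        using w norm_triangle_ineq2[of w z] by (auto simp: dist_norm norm_minus_commute)
      moreover have "real (2 * k + 1) powr (- Re w - 1) \<le> real (2 * k + 1) powr (-(1 + d))"
        using Re by (intro powr_mono) auto
      moreover have "\<dots> \<le> real (Suc k) powr (-(1 + d))"
        using d by (intro powr_mono2') auto
      ultimately have "cmod w * real (2 * k + 1) powr (- Re w - 1) \<le> h k"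
        unfolding h_def using d by (intro mult_mono) auto
      with cmod_eta_term_le[of w k] w show ?thesis by simp
    qed
    ultimately show ?thesis using d by blast
  qed
  have "open ?S" by (simp add: open_halfspace_Re_gt)
  from sums_holomorphic_on[OF this holo bnd] obtain g where
    "g holomorphic_on ?S" "\<And>z. z \<in> ?S \<Longrightarrow> (\<lambda>n. eta_term n z) sums g z" by blast
  with that[of g] show ?thesis by simp
qed

text \<open>Subtracting the even-indexed terms of the zeta series twice produces the alternating
  signs; those terms sum to \<open>2 powr (- s)\<close> times zeta.\<close>

lemma eta_term_sums_right_halfplane:
  assumes s: "Re s > 1"
  shows "(\<lambda>k. eta_term k s) sums ((1 - 2 powr (1 - s)) * riemann_zeta s)"
proof -
  let ?f = "\<lambda>n :: nat. complex_of_nat (Suc n) powr (- s)"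
  have 1: "(\<lambda>k. ?f (2 * k) + ?f (2 * k + 1)) sums riemann_zeta s"
    using sums_group[OF riemann_zeta_sums[OF s], of 2]
    by (simp add: mult.commute del: of_nat_Suc)
  have 2: "complex_of_nat (2 * k + 2) powr (- s) = 2 powr (- s) * ?f k" for k
  proof -
    have "complex_of_nat (2 * k + 2) = of_real 2 * of_real (real (Suc k))" by simp
    then show ?thesis
      using powr_times_real[of "of_real 2" "of_real (real (Suc k))" "- s"] by simp
  qed
  have "(\<lambda>k. 2 * 2 powr (- s) * ?f k) sums (2 * 2 powr (- s) * riemann_zeta s)"
    by (intro sums_mult riemann_zeta_sums s)
  from sums_diff[OF 1 this]
  have "(\<lambda>k. ?f (2 * k) + ?f (2 * k + 1) - 2 * 2 powr (- s) * ?f k)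
      sums (riemann_zeta s - 2 * 2 powr (- s) * riemann_zeta s)" .
  moreover have "?f (2 * k) + ?f (2 * k + 1) - 2 * 2 powr (- s) * ?f k = eta_term k s" for k
    using 2[of k] by (simp add: eta_term_def add_ac del: of_nat_add)
  moreover have "2 powr (1 - s) = 2 * 2 powr (- s)"
    by (simp add: powr_diff powr_minus field_simps)
  ultimately show ?thesis by (simp add: algebra_simps)
qed

text \<open>Identity theorem on the half-plane punctured at 1, which is still connected. This gives
  an explicit series for zeta on the critical line.\<close>

lemma eta_term_sums:
  assumes s: "Re s > 0" "s \<noteq> 1"
  shows "(\<lambda>k. eta_term k s) sums ((1 - 2 powr (1 - s)) * riemann_zeta s)"
proof -
  obtain H where H: "H holomorphic_on {s. Re s > 0}"
    and H_sums: "\<And>s. Re s > 0 \<Longrightarrow> (\<lambda>k. eta_term k s) sums H s"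
    using holomorphic_eta by blast
  let ?S = "{s. Re s > 0} - {1}"
  have "H s = (1 - 2 powr (1 - s)) * riemann_zeta s"
  proof (rule analytic_continuation_open[where f = H and s = "{s. Re s > 1}" and s' = ?S])
    show "{s. Re s > 1} \<noteq> {}" by (auto intro!: exI[of _ 2])
    show "connected ?S"
      by (intro connected_open_delete convex_connected convex_halfspace_Re_gt open_halfspace_Re_gt) simp
    show "H holomorphic_on ?S" by (rule holomorphic_on_subset[OF H]) auto
    show "(\<lambda>s. (1 - 2 powr (1 - s)) * riemann_zeta s) holomorphic_on ?S"
      by (intro holomorphic_intros holomorphic_on_subset[OF holomorphic_riemann_zeta]) auto
    fix w assume w: "w \<in> {s. Re s > 1}"
    then show "H w = (1 - 2 powr (1 - w)) * riemann_zeta w"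
      using H_sums[of w] eta_term_sums_right_halfplane[of w] by (simp add: sums_iff)
  qed (use s in \<open>auto simp: open_halfspace_Re_gt intro!: open_delete\<close>)
  with H_sums[OF s(1)] show ?thesis by simp
qed

text \<open>A telescoping majorant for the tail of the paired series: with x and y the two square
  roots, y^2 - x^2 = 1 gives 1 / x - 1 / y = 1 / (x y (x + y)), which is at least 1 / (2
  y^3).\<close>

lemma powr_three_halves_le:
  assumes "k \<ge> 1"
  shows "real (2 * k + 1) powr (- (3 / 2)) \<le> 2 * (1 / sqrt (real k) - 1 / sqrt (real (Suc k)))"
proof -
  define x y where "x = sqrt (real k)" and "y = sqrt (real (Suc k))"
  have xy: "x > 0" "y > 0" "x \<le> y" "y\<^sup>2 = x\<^sup>2 + 1"
    using assms by (simp_all add: x_def y_def)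
  have "real (2 * k + 1) powr (- (3 / 2)) \<le> real (Suc k) powr (- (3 / 2))"
    using assms by (intro powr_mono2') auto
  also have "real (Suc k) = y powr 2" by (simp add: y_def)
  also have "(y powr 2) powr (- (3 / 2)) = 1 / y ^ 3"
    using xy(2) by (simp only: powr_powr) (simp add: powr_minus field_simps)
  also have "\<dots> = 2 / (y * y * (y + y))"
    unfolding power3_eq_cube mult_2[symmetric] by simp
  also have "\<dots> \<le> 2 / (x * y * (x + y))"
    using xy(1-3) by (intro divide_left_mono mult_mono add_mono) auto
  also have "\<dots> = 2 * ((y\<^sup>2 - x\<^sup>2) / (x * y * (x + y)))" using xy(4) by simp
  also have "\<dots> = 2 * (1 / x - 1 / y)"
  proof -
    have "(y\<^sup>2 - x\<^sup>2) / (x * y * (x + y)) = (y - x) * (x + y) / (x * y * (x + y))"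
      by (simp add: power2_eq_square algebra_simps)
    also have "\<dots> = 1 / x - 1 / y" using xy(1,2) by (simp add: diff_divide_distrib)
    finally show ?thesis by simp
  qed
  finally show ?thesis by (simp add: x_def y_def)
qed

lemma eta_remainder_le:
  assumes s: "Re s = 1 / 2" and K: "K \<ge> 1"
  shows "cmod ((1 - 2 powr (1 - s)) * riemann_zeta s - (\<Sum>k<K. eta_term k s)) \<le> 2 * cmod s / sqrt (real K)"
proof -
  have part: "cmod ((\<Sum>k<N. eta_term k s) - (\<Sum>k<K. eta_term k s)) \<le> 2 * cmod s / sqrt (real K)"
    if N: "N \<ge> K" for N
  proof -
    have "(\<Sum>k<N. eta_term k s) - (\<Sum>k<K. eta_term k s) = (\<Sum>k=K..<N. eta_term k s)"
      using sum_diff_nat_ivl[of 0 K N "\<lambda>k. eta_term k s"] N by (simp add: lessThan_atLeast0)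
    also have "cmod \<dots> \<le> (\<Sum>k=K..<N. cmod (eta_term k s))" by (rule norm_sum)
    also have "\<dots> \<le> (\<Sum>k=K..<N. cmod s * (2 * (1 / sqrt (real k) - 1 / sqrt (real (Suc k)))))"
    proof (rule sum_mono)
      fix k assume k: "k \<in> {K..<N}"
      have "cmod (eta_term k s) \<le> cmod s * real (2 * k + 1) powr (- (3 / 2))"
        using cmod_eta_term_le[of s k] s by simp
      also have "\<dots> \<le> cmod s * (2 * (1 / sqrt (real k) - 1 / sqrt (real (Suc k))))"
        using k K by (intro mult_left_mono powr_three_halves_le) auto
      finally show "cmod (eta_term k s) \<le> cmod s * (2 * (1 / sqrt (real k) - 1 / sqrt (real (Suc k))))" .
    qed
    also have "\<dots> = 2 * cmod s * (\<Sum>k=K..<N. - 1 / sqrt (real (Suc k)) - (- 1 / sqrt (real k)))"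
      by (simp add: sum_distrib_left algebra_simps)
    also have "\<dots> = 2 * cmod s * (1 / sqrt (real K) - 1 / sqrt (real N))"
      using sum_Suc_diff'[OF N, of "\<lambda>k. - 1 / sqrt (real k)"] by simp
    also have "\<dots> \<le> 2 * cmod s * (1 / sqrt (real K))"
      by (intro mult_left_mono) auto
    finally show ?thesis by simp
  qed
  have "s \<noteq> 1" using s by auto
  then have "(\<lambda>N. \<Sum>k<N. eta_term k s) \<longlonglongrightarrow> (1 - 2 powr (1 - s)) * riemann_zeta s"
    using eta_term_sums[of s] s by (auto simp: sums_def)
  then have "(\<lambda>N. cmod ((\<Sum>k<N. eta_term k s) - (\<Sum>k<K. eta_term k s)))
      \<longlonglongrightarrow> cmod ((1 - 2 powr (1 - s)) * riemann_zeta s - (\<Sum>k<K. eta_term k s))"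
    by (intro tendsto_intros)
  then show ?thesis
    by (rule tendsto_upperbound) (use part in \<open>auto simp: eventually_sequentially\<close>)
qed

text \<open>Undoes the pairing and isolates n = 1, the one term that does not oscillate in
  t.\<close>

lemma sum_eta_term:
  assumes "K \<ge> 1"
  shows "(\<Sum>k<K. eta_term k s) = 1 + (\<Sum>n=2..2 * K. (- 1) ^ (n - 1) * of_nat n powr (- s))"
  using assms
proof (induction K rule: nat_induct_at_least)
  case base
  then show ?case by (simp add: eta_term_def)
next
  case (Suc K)
  have "(\<Sum>n=2..2 * Suc K. (- 1) ^ (n - 1) * of_nat n powr (- s)) =
     (\<Sum>n=2..2 * K. (- 1) ^ (n - 1) * of_nat n powr (- s)) + eta_term K s"
    using Suc.hyps by (simp add: eta_term_def)
  with Suc.IH show ?case by simp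
qed

text \<open>The logarithm makes the sum o(sqrt N). The application has sqrt N proportional to T, so
  a small \<open>\<epsilon>\<close> is needed to stay below the main term T.\<close>

lemma sum_inverse_sqrt_ln_le:
  fixes \<epsilon> :: real
  assumes "\<epsilon> > 0"
  obtains C where "\<And>N. (\<Sum>n=2..N. 2 / (sqrt (real n) * ln (real n))) \<le> C + \<epsilon> * sqrt (real N)"
proof -
  define b where "b = (\<lambda>n. 2 / (sqrt (real n) * ln (real n)))"
  \<comment> \<open>Past this threshold a summand is at most \<epsilon> / (2 sqrt n), hence at most
    \<epsilon> (sqrt n - sqrt (n - 1)), and the bound telescopes.\<close>
  have "\<forall>\<^sub>F n in sequentially. ln (real n) \<ge> 4 / \<epsilon>"
    using filterlim_compose[OF ln_at_top filterlim_real_sequentially]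
    by (simp add: filterlim_at_top)
  then obtain n0 where n0: "\<And>n. n \<ge> n0 \<Longrightarrow> ln (real n) \<ge> 4 / \<epsilon>"
    by (auto simp: eventually_sequentially)
  have nonneg: "b n \<ge> 0" if "n \<in> {2..N}" for n N
    using that by (auto simp: b_def)
  define C where "C = sum b {2..n0}"
  have "sum b {2..N} \<le> C + \<epsilon> * sqrt (real N)" for N
  proof (cases "N \<ge> n0")
    case True
    then show ?thesis
    proof (induction N rule: dec_induct)
      case base
      then show ?case using assms by (simp add: C_def)
    next
      case (step N)
      define x y where "x = sqrt (real N)" and "y = sqrt (real (Suc N))"
      have xy: "x \<ge> 0" "y > 0" "x \<le> y" "y\<^sup>2 - x\<^sup>2 = 1" by (simp_all add: x_def y_def)
      have ln: "ln (real (Suc N)) \<ge> 4 / \<epsilon>" by (rule n0) (use step in auto)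
      have "0 < 4 / \<epsilon>" using assms by simp
      with ln have "ln (real (Suc N)) > 0" by linarith
      then have "N > 0" by (cases N) auto
      then have "b (Suc N) \<le> 2 / (y * (4 / \<epsilon>))"
        unfolding b_def y_def[symmetric] using ln xy(2) assms
        by (intro divide_left_mono mult_left_mono mult_pos_pos) (auto intro: less_le_trans[OF _ ln])
      also have "\<dots> = \<epsilon> * (1 / (y + y))" using assms by simp
      also have "\<dots> \<le> \<epsilon> * (1 / (x + y))"
        using xy(1-3) assms by (intro mult_left_mono divide_left_mono add_mono mult_pos_pos) auto
      also have "1 / (x + y) = y - x"
      proof -
        have "(y - x) * (x + y) = 1" using xy(4) by (simp add: power2_eq_square algebra_simps)
        moreover have "x + y \<noteq> 0" using xy(1,2) by linarith
        ultimately show ?thesis by (simp add: divide_eq_eq)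
      qed
      finally have b: "b (Suc N) \<le> \<epsilon> * y - \<epsilon> * x" by (simp add: right_diff_distrib)
      have "sum b {2..Suc N} \<le> sum b {2..N} + b (Suc N)"
        by (cases "N \<ge> 1") (auto simp: b_def not_le)
      also have "\<dots> \<le> C + \<epsilon> * x + (\<epsilon> * y - \<epsilon> * x)"
        using step.IH b by (intro add_mono) (simp_all add: x_def)
      finally show ?case by (simp add: y_def)
    qed
  next
    case False
    have "sum b {2..N} \<le> C"
      unfolding C_def using False nonneg by (intro sum_mono2) auto
    moreover have "0 \<le> \<epsilon> * sqrt (real N)" using assms by simp
    ultimately show ?thesis by linarith
  qed
  then show ?thesis using that[of C] unfolding b_def by blast
qed

lemma dirichlet_term_has_integral:
  fixes a b :: real
  assumes n: "n \<ge> 2" and ab: "a \<le> b"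
  obtains I where "((\<lambda>t. of_nat n powr (- Complex (1 / 2) t)) has_integral I) {a..b}"
    "cmod I \<le> 2 / (sqrt (real n) * ln (real n))"
proof -
  define L where "L = ln (real n)"
  have L: "L > 0" using n by (simp add: L_def)
  \<comment> \<open>An explicit antiderivative of constant modulus on the line; each of the two
    endpoints costs 1 / (sqrt n ln n).\<close>
  define F where "F = (\<lambda>t. \<i> / of_real L * exp (- (1 / 2 + \<i> * t) * of_real L))"
  have powr: "of_nat n powr (- Complex (1 / 2) t) = exp (- (1 / 2 + \<i> * of_real t) * of_real L)" for t
    using n by (simp add: powr_def Complex_eq L_def Ln_of_nat)
  have "((\<lambda>t. F (of_real t)) has_vector_derivative of_nat n powr (- Complex (1 / 2) t)) (at t within {a..b})" for t
    unfolding powr F_def using L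
    by (intro has_vector_derivative_real_field)
       (auto intro!: derivative_eq_intros simp: field_simps)
  then have int: "((\<lambda>t. of_nat n powr (- Complex (1 / 2) t)) has_integral (F (of_real b) - F (of_real a))) {a..b}"
    using ab by (intro fundamental_theorem_of_calculus)
  have F: "cmod (F (of_real t)) = 1 / (sqrt (real n) * L)" for t :: real
  proof -
    have "exp (- (L / 2)) = 1 / sqrt (real n)"
      using n by (simp add: L_def exp_minus flip: ln_sqrt) (simp add: divide_inverse)
    then show ?thesis using L by (simp add: F_def norm_mult norm_divide)
  qed
  have "cmod (F (of_real b) - F (of_real a)) \<le> 1 / (sqrt (real n) * L) + 1 / (sqrt (real n) * L)"
    using norm_triangle_ineq4[of "F (of_real b)" "F (of_real a)"] by (simp only: F)
  then show ?thesis using that[OF int] by (simp add: L_def)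
qed

lemma continuous_on_riemann_zeta_critical_line:
  "continuous_on A (\<lambda>t. riemann_zeta (Complex (1 / 2) t))"
proof -
  have "continuous_on A (\<lambda>t. Complex (1 / 2) t)"
    unfolding Complex_eq by (intro continuous_intros)
  moreover have "(\<lambda>t. Complex (1 / 2) t) ` A \<subseteq> - {1}" by (auto simp: complex_eq_iff)
  ultimately show ?thesis
    using holomorphic_on_imp_continuous_on[OF holomorphic_riemann_zeta]
    by (rule continuous_on_compose2[rotated])
qed

lemma eta_mean_square_lower_bound:
  obtains C where "\<And>T :: nat. T \<ge> 1 \<Longrightarrow>
    real T / 2 - C \<le> integral {real T..2 * real T} (\<lambda>t.
      (cmod ((1 - 2 powr (1 - Complex (1 / 2) t)) * riemann_zeta (Complex (1 / 2) t)))\<^sup>2)"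
proof -
  \<comment> \<open>The sum will run to 2K with sqrt K = 48 T, so sqrt (2K) is at most 96 T, and 96
    / 768 = 1/8.\<close>
  obtain C where C: "\<And>N. (\<Sum>n=2..N. 2 / (sqrt (real n) * ln (real n))) \<le> C + 1 / 768 * sqrt (real N)"
    using sum_inverse_sqrt_ln_le[of "1 / 768"] by auto
  define s where "s = (\<lambda>t. Complex (1 / 2) t)"
  define \<eta> where "\<eta> = (\<lambda>t. (1 - 2 powr (1 - s t)) * riemann_zeta (s t))"
  have cont: "continuous_on A \<eta>" for A
    unfolding \<eta>_def s_def
    by (intro continuous_intros continuous_on_riemann_zeta_critical_line)
       (auto simp: Complex_eq intro!: continuous_intros)
  have "real T / 2 - C \<le> integral {real T..2 * real T} (\<lambda>t. (cmod (\<eta> t))\<^sup>2)" if T: "T \<ge> 1" for T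
  proof -
    \<comment> \<open>On [T, 2T] one has |s| \<le> 3T, so the tail bound 2 |s| / sqrt K becomes 6T /
      (48T) = 1/8.\<close>
    define K where "K = (48 * T)\<^sup>2"
    have K: "K \<ge> 1" "sqrt (real K) = 48 * real T" 
    proof -
      show "K \<ge> 1" using T by (simp add: K_def)
      have "real K = (48 * real T)\<^sup>2" by (simp add: K_def)
      then show "sqrt (real K) = 48 * real T" by (simp only: real_sqrt_abs)
    qed
    define P where "P = (\<lambda>t. \<Sum>k<K. eta_term k (s t))"
    have "\<exists>I. ((\<lambda>t. of_nat n powr (- s t)) has_integral I) {real T..2 * real T} \<and>
        cmod I \<le> 2 / (sqrt (real n) * ln (real n))" if "n \<in> {2..2 * K}" for n
      using dirichlet_term_has_integral[of n "real T" "2 * real T"] that unfolding s_def by auto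
    then obtain I where I: "\<And>n. n \<in> {2..2 * K} \<Longrightarrow>
         ((\<lambda>t. of_nat n powr (- s t)) has_integral I n) {real T..2 * real T}"
      and I_le: "\<And>n. n \<in> {2..2 * K} \<Longrightarrow> cmod (I n) \<le> 2 / (sqrt (real n) * ln (real n))"
      by metis
    define J where "J = (\<Sum>n=2..2 * K. (- 1) ^ (n - 1) * I n)"
    have "((\<lambda>t. 1 + (\<Sum>n=2..2 * K. (- 1) ^ (n - 1) * of_nat n powr (- s t))) has_integral (of_nat T + J))
        {real T..2 * real T}"
      unfolding J_def
      using has_integral_const_real[of "1 :: complex" "real T" "2 * real T"]
      by (intro has_integral_add has_integral_sum has_integral_mult_right I) (auto simp: scaleR_conv_of_real)
    then have P: "(P has_integral (of_nat T + J)) {real T..2 * real T}"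
      by (simp add: P_def sum_eta_term[OF K(1)])
    have J: "cmod J \<le> C + real T / 8"
    proof -
      have "cmod J \<le> (\<Sum>n=2..2 * K. cmod ((- 1) ^ (n - 1) * I n))"
        unfolding J_def by (rule norm_sum)
      also have "\<dots> \<le> (\<Sum>n=2..2 * K. 2 / (sqrt (real n) * ln (real n)))"
        by (intro sum_mono) (use I_le in \<open>simp add: norm_mult norm_power\<close>)
      also have "\<dots> \<le> C + 1 / 768 * sqrt (real (2 * K))" by (rule C)
      also have "sqrt (real (2 * K)) \<le> 2 * (48 * real T)"
        unfolding K(2)[symmetric] using mult_right_mono[of "sqrt 2" 2 "sqrt (real K)"] sqrt2_less_2
        by (simp add: real_sqrt_mult)
      finally show ?thesis by simp
    qed
    define Z where "Z = integral {real T..2 * real T} \<eta>"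
    have \<eta>: "(\<eta> has_integral Z) {real T..2 * real T}"
      unfolding Z_def by (intro integrable_integral integrable_continuous_real cont)
    have R: "cmod (\<eta> t - P t) \<le> 1 / 8" if t: "t \<in> {real T..2 * real T}" for t
    proof -
      have "cmod (\<eta> t - P t) \<le> 2 * cmod (s t) / sqrt (real K)"
        unfolding \<eta>_def P_def by (rule eta_remainder_le) (use K in \<open>simp_all add: s_def\<close>)
      also have "cmod (s t) \<le> 1 / 2 + t"
        using cmod_le[of "s t"] t by (simp add: s_def)
      also have "1 / 2 + t \<le> 3 * real T" using t T by simp
      also have "2 * (3 * real T) / sqrt (real K) = 1 / 8" using K T by simp
      finally show ?thesis by (simp add: divide_right_mono)
    qed
    have "cmod (Z - (of_nat T + J)) \<le> 1 / 8 * measure lborel {real T..2 * real T}"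
      by (rule has_integral_bound_real[OF _ _ has_integral_diff[OF \<eta> P], where S = "{}"]) (use R in auto)
    then have ZTJ: "cmod (Z - (of_nat T + J)) \<le> real T / 8" by simp
    have "real T = cmod (Z - J - (Z - (of_nat T + J)))" by simp
    also have "\<dots> \<le> cmod Z + cmod J + cmod (Z - (of_nat T + J))"
      by (meson add_mono norm_triangle_ineq4 order_refl order_trans)
    \<comment> \<open>Main term T, minus T/8 + C for the oscillating terms, minus T/8 for the
      tail.\<close>
    finally have Z: "cmod Z \<ge> 3 / 4 * real T - C" using J ZTJ by simp
    have "cmod Z \<le> integral {real T..2 * real T} (\<lambda>t. cmod (\<eta> t))"
      unfolding Z_def by (intro integral_norm_bound_integral integrable_continuous_real continuous_intros cont) auto
    \<comment> \<open>From (x - 1/2)^2 \<ge> 0. The cost T/4 still leaves T/2 of the lower bound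
      3T/4.\<close>
    also have "\<dots> \<le> integral {real T..2 * real T} (\<lambda>t. (cmod (\<eta> t))\<^sup>2 + 1 / 4)"
    proof (intro integral_le integrable_continuous_real continuous_intros cont)
      fix t
      show "cmod (\<eta> t) \<le> (cmod (\<eta> t))\<^sup>2 + 1 / 4"
        using zero_le_power2[of "cmod (\<eta> t) - 1 / 2"] by (simp add: power2_eq_square algebra_simps)
    qed
    also have "\<dots> = integral {real T..2 * real T} (\<lambda>t. (cmod (\<eta> t))\<^sup>2) + real T / 4"
      by (subst integral_add) (auto intro!: integrable_continuous_real continuous_intros cont)
    finally show ?thesis using Z by simp
  qed
  then show ?thesis using that unfolding \<eta>_def s_def by blast
qed

text \<open>On the critical line the factor \<open>1 - 2 powr (1 - s)\<close> has modulus at most 3,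
  so the mean square of eta is at most 9 times that of zeta.\<close>

lemma riemann_zeta_mean_square_unbounded:
  "\<exists>T\<ge>0. B < integral {0..T} (\<lambda>t. (cmod (riemann_zeta (Complex (1 / 2) t)))\<^sup>2)"
proof -
  let ?w = "\<lambda>t. (cmod (riemann_zeta (Complex (1 / 2) t)))\<^sup>2"
  let ?v = "\<lambda>t. (cmod ((1 - 2 powr (1 - Complex (1 / 2) t)) * riemann_zeta (Complex (1 / 2) t)))\<^sup>2"
  obtain C where C: "\<And>T :: nat. T \<ge> 1 \<Longrightarrow> real T / 2 - C \<le> integral {real T..2 * real T} ?v"
    using eta_mean_square_lower_bound by blast
  obtain T :: nat where T: "real T > max 1 (2 * (C + 9 * B))"
    using reals_Archimedean2 by blast
  have w: "?w integrable_on {a..b}" for a b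
    by (intro integrable_continuous_real continuous_intros continuous_on_riemann_zeta_critical_line)
  have le: "?v t \<le> 9 * ?w t" for t
  proof -
    have "cmod (1 - 2 powr (1 - Complex (1 / 2) t)) \<le> 1 + cmod (of_real 2 powr (1 - Complex (1 / 2) t))"
      using norm_triangle_ineq4[of 1 "2 powr (1 - Complex (1 / 2) t)"] by simp
    also have "cmod (of_real 2 powr (1 - Complex (1 / 2) t)) \<le> 2"
      using powr_mono[of "1 / 2" 1 "2::real"] by (subst norm_powr_real_powr) auto
    finally have "cmod (1 - 2 powr (1 - Complex (1 / 2) t)) \<le> 3" by simp
    then have "(cmod (1 - 2 powr (1 - Complex (1 / 2) t)))\<^sup>2 \<le> 3\<^sup>2" by (intro power_mono) auto
    then show ?thesis by (simp add: norm_mult power_mult_distrib mult_right_mono)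
  qed
  have "9 * B < real T / 2 - C" using T by simp
  also have "\<dots> \<le> integral {real T..2 * real T} ?v" by (rule C) (use T in auto)
  also have "\<dots> \<le> integral {real T..2 * real T} (\<lambda>t. 9 * ?w t)"
    by (intro integral_le le integrable_continuous_real continuous_intros continuous_on_riemann_zeta_critical_line)
       (auto simp: Complex_eq intro!: continuous_intros)
  also have "\<dots> = 9 * integral {real T..2 * real T} ?w" by simp
  also have "integral {real T..2 * real T} ?w \<le> integral {0..2 * real T} ?w"
    by (intro integral_subset_le w) auto
  finally show ?thesis by (intro exI[of _ "2 * real T"]) auto
qed

subsection \<open>Differentiability of Jacob's ladder\<close>

text \<open>Moves a variable upper limit into the integrand, so that continuity of integrals over a
  fixed interval applies.\<close>

lemma integral_rescale:
  fixes f :: "real \<Rightarrow> real"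
  assumes "u \<ge> 0" "continuous_on {0..u} f"
  shows "integral {0..u} f = u * integral {0..1} (\<lambda>x. f (u * x))"
proof -
  have "((\<lambda>x. u *\<^sub>R f (u * x)) has_integral (integral {u * 0..u * 1} f)) {0..1}"
  proof (rule has_integral_substitution[where c = 0 and d = u])
    show "(*) u ` {0..1} \<subseteq> {0..u}" using assms(1) by (auto simp: mult_left_le)
  qed (use assms in \<open>auto intro!: derivative_eq_intros\<close>)
  from integral_unique[OF this] show ?thesis by simp
qed

lemma continuous_on_integral_upper_param:
  fixes h :: "real \<Rightarrow> real \<Rightarrow> real"
  assumes h: "continuous_on (UNIV \<times> Y) (\<lambda>(t, y). h t y)"
  shows "continuous_on ({0<..} \<times> Y) (\<lambda>(u, y). integral {0..u} (\<lambda>t. h t y))"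
proof -
  have "continuous_on (({0<..} \<times> Y) \<times> cbox 0 1) (\<lambda>(p, x). h (fst p * x) (snd p))"
    unfolding split_beta
    by (rule continuous_on_compose2[OF h, where f = "\<lambda>q. (fst (fst q) * snd q, snd (fst q))", simplified])
       (auto intro!: continuous_intros)
  from integral_continuous_on_param[OF this]
  have "continuous_on ({0<..} \<times> Y) (\<lambda>p. fst p * integral {0..1} (\<lambda>x. h (fst p * x) (snd p)))"
    by (intro continuous_intros) simp
  moreover have "fst p * integral {0..1} (\<lambda>x. h (fst p * x) (snd p)) = (\<lambda>(u, y). integral {0..u} (\<lambda>t. h t y)) p"
    if p: "p \<in> {0<..} \<times> Y" for p
  proof -
    have "continuous_on {0..fst p} (\<lambda>t. h t (snd p))"
      by (rule continuous_on_compose2[OF h, where f = "\<lambda>t. (t, snd p)", simplified])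
         (use p in \<open>auto intro!: continuous_intros\<close>)
    then show ?thesis using integral_rescale[of "fst p" "\<lambda>t. h t (snd p)"] p
      by (auto simp: split_beta)
  qed
  ultimately show ?thesis by (rule continuous_on_eq)
qed

text \<open>Chain rule for \<open>y \<mapsto> (\<mu> y, y)\<close> followed by the integral as a
  function of upper limit and parameter. Total differentiability comes from the partial derivatives;
  it requires the parameter derivative to be jointly continuous and given as a bounded linear map,
  which explains \<open>fy\<close>.\<close>

lemma has_real_derivative_integral_upper_param:
  fixes h h' :: "real \<Rightarrow> real \<Rightarrow> real"
  assumes Y: "open Y" "convex Y" "y \<in> Y"
    and h: "continuous_on (UNIV \<times> Y) (\<lambda>(t, y). h t y)"
    and h': "continuous_on (UNIV \<times> Y) (\<lambda>(t, y). h' t y)"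
    and deriv: "\<And>t y. y \<in> Y \<Longrightarrow> ((\<lambda>y. h t y) has_real_derivative h' t y) (at y)"
    and \<mu>: "(\<mu> has_real_derivative d) (at y)" "\<mu> y > 0"
  shows "((\<lambda>y. integral {0..\<mu> y} (\<lambda>t. h t y)) has_real_derivative
      (h (\<mu> y) y * d + integral {0..\<mu> y} (\<lambda>t. h' t y))) (at y)"
proof -
  \<comment> \<open>Only positive limits: for \<open>u < 0\<close> the interval
    \<open>{0..u}\<close> is empty and the integral is 0 instead of changing sign.\<close>
  define X where "X = {0::real<..}"
  define f where "f = (\<lambda>u y. integral {0..u} (\<lambda>t. h t y))"
  define fy where "fy = (\<lambda>u y. blinfun_mult_right (integral {0..u} (\<lambda>t. h' t y)))"
  have hc: "continuous_on A (\<lambda>t. h t z)" if "z \<in> Y" for A z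
    by (rule continuous_on_compose2[OF h, where f = "\<lambda>t. (t, z)", simplified])
       (use that in \<open>auto intro!: continuous_intros\<close>)
  have "((\<lambda>(u, y). f u y) has_derivative (\<lambda>(tu, ty). h (\<mu> y) y * tu + fy (\<mu> y) y ty))
      (at (\<mu> y, y) within X \<times> Y)"
  proof (rule has_derivative_partialsI)
    have "((\<lambda>u. f u y) has_real_derivative h (\<mu> y) y) (at (\<mu> y) within {0..\<mu> y + 1})"
      unfolding f_def by (rule integral_has_real_derivative) (use \<mu> hc Y in auto)
    moreover have "at (\<mu> y) within {0..\<mu> y + 1} = at (\<mu> y)"
      using \<mu>(2) by (intro at_within_interior) auto
    ultimately have "((\<lambda>u. f u y) has_real_derivative h (\<mu> y) y) (at (\<mu> y))" by simp
    then show "((\<lambda>u. f u y) has_derivative (*) (h (\<mu> y) y)) (at (\<mu> y) within X)"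
      by (simp add: has_field_derivative_def has_derivative_at_withinI)
  next
    fix u z assume u: "u \<in> X" and z: "z \<in> Y"
    have "((\<lambda>z. integral (cbox 0 u) (\<lambda>t. h t z)) has_real_derivative integral (cbox 0 u) (\<lambda>t. h' t z)) (at z within Y)"
    proof (rule leibniz_rule_field_derivative)
      show "continuous_on (Y \<times> cbox 0 u) (\<lambda>(z, t). h' t z)"
        unfolding split_beta
        by (rule continuous_on_compose2[OF h', where f = "\<lambda>q. (snd q, fst q)", simplified])
           (auto intro!: continuous_intros)
      show "(\<lambda>t. h t z) integrable_on cbox 0 u" if "z \<in> Y" for z
        by (intro integrable_continuous hc that)
    qed (use deriv z Y in \<open>auto intro: DERIV_subset\<close>)
    then show "((\<lambda>z. f u z) has_derivative blinfun_apply (fy u z)) (at z within Y)"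
      unfolding f_def fy_def by (simp add: has_field_derivative_def blinfun_mult_right.rep_eq)
  next
    have "continuous_on (X \<times> Y) (\<lambda>(u, y). fy u y)"
      unfolding fy_def split_beta X_def
      using continuous_on_integral_upper_param[OF h'] unfolding split_beta
      by (intro bounded_linear.continuous_on[OF bounded_linear_blinfun_mult_right])
    then show "continuous (at (\<mu> y, y) within X \<times> Y) (\<lambda>(u, y). fy u y)"
      using \<mu>(2) Y by (simp add: continuous_on_eq_continuous_within X_def)
  qed (use Y in auto)
  moreover have "at (\<mu> y, y) within X \<times> Y = at (\<mu> y, y)"
    using \<mu>(2) Y by (intro at_within_open) (auto simp: X_def intro!: open_Times)
  ultimately have f: "((\<lambda>(u, y). f u y) has_derivative (\<lambda>(tu, ty). h (\<mu> y) y * tu + fy (\<mu> y) y ty)) (at (\<mu> y, y))"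
    by simp
  have "((\<lambda>z. (\<mu> z, z)) has_derivative (\<lambda>t. (d * t, t))) (at y)"
    using \<mu>(1) by (intro has_derivative_Pair) (auto simp: has_field_derivative_def)
  from has_derivative_compose[OF this f]
  have "((\<lambda>z. f (\<mu> z) z) has_derivative (\<lambda>t. h (\<mu> y) y * (d * t) + fy (\<mu> y) y t)) (at y)"
    by simp
  moreover have "(\<lambda>t. h (\<mu> y) y * (d * t) + fy (\<mu> y) y t)
      = (*) (h (\<mu> y) y * d + integral {0..\<mu> y} (\<lambda>t. h' t y))"
    by (simp add: fun_eq_iff fy_def blinfun_mult_right.rep_eq algebra_simps)
  ultimately show ?thesis
    unfolding has_field_derivative_def f_def by simp
qed

section \<open>Hardy's function and the regularity of the ladder\<close>

lemma cmod_hardy_Z: "cmod (hardy_Z t) = cmod (riemann_zeta (Complex (1 / 2) t))"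
  by (simp add: hardy_Z_def norm_mult)

lemma continuous_on_hardy_Z_square: "continuous_on A (\<lambda>t. (cmod (hardy_Z t))\<^sup>2)"
  unfolding cmod_hardy_Z by (intro continuous_intros continuous_on_riemann_zeta_critical_line)

lemma integral_hardy_Z_square_pos:
  assumes ab: "a < b"
  shows "integral {a..b} (\<lambda>t. (cmod (hardy_Z t))\<^sup>2) > 0"
proof (rule ccontr)
  assume "\<not> ?thesis"
  moreover have "integral {a..b} (\<lambda>t. (cmod (hardy_Z t))\<^sup>2) \<ge> 0"
    by (intro integral_nonneg integrable_continuous_real continuous_on_hardy_Z_square) auto
  ultimately have int0: "integral {a..b} (\<lambda>t. (cmod (hardy_Z t))\<^sup>2) = 0" by linarith
  have "(cmod (hardy_Z t))\<^sup>2 = 0" if "t \<in> {a..b}" for t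
  proof (rule has_integral_0_cbox_imp_0[where a = a and b = b and f = "\<lambda>t. (cmod (hardy_Z t))\<^sup>2"])
    show "((\<lambda>t. (cmod (hardy_Z t))\<^sup>2) has_integral 0) (cbox a b)"
      using integrable_integral[OF integrable_continuous_real[OF continuous_on_hardy_Z_square[of "{a..b}"]]]
      by (simp add: int0)
  qed (use ab that in \<open>auto intro: continuous_on_hardy_Z_square\<close>)
  then have zero: "riemann_zeta (Complex (1 / 2) t) = 0" if "t \<in> {a..b}" for t
    using that by (simp add: cmod_hardy_Z)
  have "riemann_zeta w = 0" if w: "w \<in> - {1}" for w
  proof (rule analytic_continuation[OF holomorphic_riemann_zeta, where U = "Complex (1 / 2) ` {a..b}" and \<xi> = "Complex (1 / 2) a"])
    show "connected (- {1::complex})"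
      using connected_open_delete[of "UNIV :: complex set" 1] convex_connected[OF convex_UNIV] by (simp add: Compl_eq_Diff_UNIV)
    show "Complex (1 / 2) a islimpt Complex (1 / 2) ` {a..b}"
      unfolding islimpt_approachable
    proof (intro allI impI)
      fix e :: real assume e: "e > 0"
      define t where "t = a + min (e / 2) (b - a)"
      have "t \<in> {a..b}" "t \<noteq> a" using e ab by (auto simp: t_def min_def)
      moreover have "dist (Complex (1 / 2) t) (Complex (1 / 2) a) < e"
        using e ab by (simp add: dist_norm complex_diff cmod_def t_def)
      ultimately show "\<exists>z\<in>Complex (1 / 2) ` {a..b}. z \<noteq> Complex (1 / 2) a \<and> dist z (Complex (1 / 2) a) < e"
        by auto
    qed
  qed (use w zero in \<open>auto simp: complex_eq_iff\<close>)
  then have "riemann_zeta (Complex (1 / 2) t) = 0" for t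
    by (simp add: complex_eq_iff)
  \<comment> \<open>A vanishing zeta would make every mean square 0, against the unboundedness with
    bound 0.\<close>
  then show False using riemann_zeta_mean_square_unbounded[of 0] by simp
qed

text \<open>A ladder is given only as a function that eventually solves the integral equation; all
  its regularity is extracted from \<open>\<Phi> (\<phi> T) = W T\<close>.\<close>

lemma jacobs_ladder_C1_strict_mono:
  assumes \<mu>: "admissible_mu y0 \<mu>" and \<phi>: "jacobs_ladder y0 \<mu> \<phi>"
  obtains t0 D where "\<And>t. t \<ge> t0 \<Longrightarrow> (\<phi> has_real_derivative D t) (at t)" "continuous_on {t0..} D"
    "strict_mono_on {t0..} \<phi>" "filterlim \<phi> at_top at_top"
proof -
  define w where "w = (\<lambda>t. (cmod (hardy_Z t))\<^sup>2)"
  define W where "W = (\<lambda>T. integral {0..T} w)"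
  define h where "h = (\<lambda>t y. w t * exp (- (2 / y) * t))"
  define h' where "h' = (\<lambda>t y. w t * (exp (- (2 / y) * t) * (2 * t / y\<^sup>2)))"
  define \<Phi> where "\<Phi> = (\<lambda>y. integral {0..\<mu> y} (\<lambda>t. h t y))"
  have wc: "continuous_on A w" for A unfolding w_def by (rule continuous_on_hardy_Z_square)
  have wi: "w integrable_on {a..b}" for a b by (intro integrable_continuous_real wc)
  have w0: "w t \<ge> 0" for t by (simp add: w_def)
  have wpos: "integral {a..b} w > 0" if "a < b" for a b
    unfolding w_def by (rule integral_hardy_Z_square_pos[OF that])
  have hi: "(\<lambda>t. h t y) integrable_on {a..b}" for y a b
    unfolding h_def by (intro integrable_continuous_real continuous_intros wc)
  have h0: "h t y \<ge> 0" for t y by (simp add: h_def w0)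
  have y0: "y0 > 0" and mono: "mono_on {y0..} \<mu>" using \<mu> by (auto simp: admissible_mu_def)
  have W_less: "W S < W T" if "0 \<le> S" "S < T" for S T
    using Henstock_Kurzweil_Integration.integral_combine[of 0 S T w] wpos[of S T] wi that by (simp add: W_def)
  have W_le: "W S \<le> W T" if "0 \<le> S" "S \<le> T" for S T
    using W_less[of S T] that by (cases "S = T") auto
  have W_unbounded: "\<exists>T\<ge>0. B < W T" for B
    using riemann_zeta_mean_square_unbounded[of B] by (simp add: W_def w_def cmod_hardy_Z)
  \<comment> \<open>Weak monotonicity on all of \<open>[y0, \<infinity>)\<close>, where
    \<open>\<Phi>\<close> need not be differentiable. It orders the values of \<open>\<phi>\<close>
    before they are known to lie in \<open>S\<close>.\<close>
  have \<Phi>_mono: "\<Phi> y \<le> \<Phi> z" if "y0 \<le> y" "y \<le> z" for y z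
  proof -
    have "\<Phi> y \<le> integral {0..\<mu> y} (\<lambda>t. h t z)"
      unfolding \<Phi>_def
    proof (intro integral_le hi)
      fix t assume t: "t \<in> {0..\<mu> y}"
      have "2 / z \<le> 2 / y" using that y0 by (intro divide_left_mono) auto
      then have "exp (- (2 / y) * t) \<le> exp (- (2 / z) * t)"
        using mult_right_mono[of "2 / z" "2 / y" t] t by simp
      then show "h t y \<le> h t z" by (simp add: h_def mult_left_mono w0)
    qed
    also have "\<dots> \<le> \<Phi> z"
      unfolding \<Phi>_def
      using mono_onD[OF mono, of y z] that by (intro integral_subset_le hi) (auto simp: h0)
    finally show ?thesis .
  qed
  obtain T1 where T1: "T1 > 0" "\<And>T. T \<ge> T1 \<Longrightarrow> \<phi> T \<ge> y0 \<and> \<Phi> (\<phi> T) = W T"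
  proof -
    obtain N where "\<And>T. T \<ge> N \<Longrightarrow> \<phi> T \<ge> y0 \<and> \<Phi> (\<phi> T) = W T"
      using \<phi> unfolding jacobs_ladder_def eventually_at_top_linorder \<Phi>_def h_def W_def w_def by auto
    then show ?thesis using that[of "max N 1"] by auto
  qed
  define y1 where "y1 = \<phi> T1"
  define S where "S = {y1<..}"
  have y1: "y1 \<ge> y0" using T1(2)[of T1] by (simp add: y1_def)
  \<comment> \<open>Otherwise \<open>{0..\<mu> y1}\<close> is empty or a point and the integral is
    0, while \<open>\<Phi> y1 = W T1 > 0\<close>. Monotonicity of \<open>\<mu>\<close> carries
    positivity to all of \<open>S\<close>.\<close>
  have "\<mu> y1 > 0"
  proof (rule ccontr)
    assume "\<not> \<mu> y1 > 0"
    then have "\<Phi> y1 = 0"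
      by (cases "\<mu> y1 = 0") (auto simp: \<Phi>_def)
    moreover have "\<Phi> y1 > 0" using T1 wpos[of 0 T1] by (simp add: y1_def W_def)
    ultimately show False by simp
  qed
  then have \<mu>_pos: "\<mu> y > 0" if "y \<in> S" for y
    using mono_onD[OF mono, of y1 y] that y1 by (auto simp: S_def)
  obtain \<mu>' where \<mu>': "\<And>y. y > y0 \<Longrightarrow> (\<mu> has_real_derivative \<mu>' y) (at y)"
    and \<mu>'_cont: "continuous_on {y0<..} \<mu>'"
  proof -
    obtain E :: "nat \<Rightarrow> real \<Rightarrow> real" where E0: "\<And>y. y \<ge> y0 \<Longrightarrow> E 0 y = \<mu> y"
      and E: "\<And>k y. y \<ge> y0 \<Longrightarrow> (E k has_real_derivative E (Suc k) y) (at y within {y0..})"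
    proof -
      have "smooth_on_atLeast y0 \<mu>" using \<mu> by (simp add: admissible_mu_def)
      then obtain E where "\<forall>y\<ge>y0. E 0 y = \<mu> y"
        "\<forall>k. \<forall>y\<ge>y0. (E k has_real_derivative E (Suc k) y) (at y within {y0..})"
        unfolding smooth_on_atLeast_def by blast
      then show ?thesis using that[of E] by blast
    qed
    have E': "(E k has_real_derivative E (Suc k) y) (at y)" if "y > y0" for k y
    proof -
      have "at y within {y0..} = at y" using that by (intro at_within_interior) simp
      then show ?thesis using E[of y k] that by simp
    qed
    have "(\<mu> has_real_derivative E 1 y) (at y)" if "y > y0" for y
    proof (rule has_field_derivative_transform_within_open[where S = "{y0<..}"])
      show "(E 0 has_real_derivative E 1 y) (at y)" using E'[OF that, of 0] by simp
    qed (use that E0 in auto)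
    moreover have "continuous_on {y0<..} (E 1)"
      by (rule DERIV_continuous_on) (use E' in \<open>auto intro: has_field_derivative_at_within\<close>)
    ultimately show ?thesis using that by blast
  qed
  have \<mu>'_nonneg: "\<mu>' y \<ge> 0" if "y > y0" for y
    by (rule mono_on_imp_deriv_nonneg[OF mono \<mu>'[OF that]]) (use that in simp)
  define \<Phi>' where "\<Phi>' = (\<lambda>y. h (\<mu> y) y * \<mu>' y + integral {0..\<mu> y} (\<lambda>t. h' t y))"
  have w_fst: "continuous_on A (\<lambda>p :: real \<times> real. w (fst p))" for A
    by (rule continuous_on_compose2[OF wc[of UNIV]]) (auto intro!: continuous_intros)
  have hc: "continuous_on (UNIV \<times> {0<..}) (\<lambda>(t, y). h t y)"
    unfolding h_def split_beta by (intro continuous_intros w_fst) auto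
  have h'c: "continuous_on (UNIV \<times> {0<..}) (\<lambda>(t, y). h' t y)"
    unfolding h'_def split_beta by (intro continuous_intros w_fst) auto
  have S_sub: "y > y0" "y > 0" if "y \<in> S" for y
    using that y1 y0 by (auto simp: S_def)
  have \<Phi>_deriv: "(\<Phi> has_real_derivative \<Phi>' y) (at y)" if y: "y \<in> S" for y
    unfolding \<Phi>_def \<Phi>'_def
  proof (rule has_real_derivative_integral_upper_param[where Y = "{0<..}"])
    fix t z :: real assume "z \<in> {0<..}"
    then show "((\<lambda>y. h t y) has_real_derivative h' t z) (at z)"
      unfolding h_def h'_def
      by (auto intro!: derivative_eq_intros simp: power2_eq_square)
  qed (use S_sub[OF y] \<mu>_pos[OF y] hc h'c \<mu>' in auto)
  have \<Phi>'_pos: "\<Phi>' y > 0" if y: "y \<in> S" for y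
  proof -
    define m where "m = \<mu> y"
    have m: "m > 0" using \<mu>_pos[OF y] by (simp add: m_def)
    have y': "y > 0" using S_sub[OF y] by simp
    \<comment> \<open>A lower bound on \<open>[m / 2, m]\<close> for the factor of
      \<open>w t\<close> in \<open>h'\<close>: the exponential is least at \<open>t = m\<close>, and
      2t \<ge> m. The boundary term is nonnegative since \<open>\<mu>\<close> increases.\<close>
    define c where "c = exp (- (2 / y) * m) * (m / y\<^sup>2)"
    have c: "c > 0" using m y' by (simp add: c_def)
    have h'i: "(\<lambda>t. h' t y) integrable_on {a..b}" for a b
      unfolding h'_def using y' by (intro integrable_continuous_real continuous_intros wc) auto
    have "0 < c * integral {m / 2..m} w" using c wpos[of "m / 2" m] m by simp
    also have "\<dots> = integral {m / 2..m} (\<lambda>t. w t * c)" by (simp add: mult.commute)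
    also have "\<dots> \<le> integral {m / 2..m} (\<lambda>t. h' t y)"
    proof (intro integral_le h'i)
      show "(\<lambda>t. w t * c) integrable_on {m / 2..m}"
        by (intro integrable_continuous_real continuous_intros wc)
      fix t assume t: "t \<in> {m / 2..m}"
      have "(2 / y) * t \<le> (2 / y) * m" using t y' by (intro mult_left_mono) auto
      then have "exp (- (2 / y) * m) \<le> exp (- (2 / y) * t)" by simp
      moreover have "m / y\<^sup>2 \<le> 2 * t / y\<^sup>2" using t y' by (intro divide_right_mono) auto
      ultimately show "w t * c \<le> h' t y"
        unfolding c_def h'_def using m y' by (intro mult_left_mono mult_mono w0) auto
    qed
    also have "\<dots> \<le> integral {0..m} (\<lambda>t. h' t y)"
      using m by (intro integral_subset_le h'i) (auto simp: h'_def w0)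
    finally have "0 < integral {0..m} (\<lambda>t. h' t y)" .
    moreover have "0 \<le> h (\<mu> y) y * \<mu>' y"
      using h0 \<mu>'_nonneg S_sub[OF y] by simp
    ultimately show ?thesis by (simp add: \<Phi>'_def m_def)
  qed
  have \<mu>c: "continuous_on S \<mu>"
    by (rule DERIV_continuous_on) (use \<mu>' S_sub in \<open>auto intro: has_field_derivative_at_within\<close>)
  have \<Phi>c: "continuous_on S \<Phi>"
    by (rule DERIV_continuous_on) (use \<Phi>_deriv in \<open>auto intro: has_field_derivative_at_within\<close>)
  have \<Phi>'c: "continuous_on S \<Phi>'"
    unfolding \<Phi>'_def
  proof (intro continuous_intros)
    show "continuous_on S (\<lambda>y. h (\<mu> y) y)"
      by (rule continuous_on_compose2[OF hc, where f = "\<lambda>y. (\<mu> y, y)", simplified])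
         (use S_sub in \<open>auto intro!: continuous_intros \<mu>c\<close>)
    show "continuous_on S \<mu>'"
      by (rule continuous_on_subset[OF \<mu>'_cont]) (use S_sub in auto)
    show "continuous_on S (\<lambda>y. integral {0..\<mu> y} (\<lambda>t. h' t y))"
      by (rule continuous_on_compose2[OF continuous_on_integral_upper_param[OF h'c], where f = "\<lambda>y. (\<mu> y, y)", simplified])
         (use S_sub \<mu>_pos in \<open>auto intro!: continuous_intros \<mu>c\<close>)
  qed
  have \<Phi>_less: "\<Phi> y < \<Phi> z" if "y \<in> S" "y < z" for y z
  proof (rule DERIV_pos_imp_increasing[OF that(2)])
    fix x assume "y \<le> x" "x \<le> z"
    then have "x \<in> S" using that by (auto simp: S_def)
    then show "\<exists>d. (\<Phi> has_real_derivative d) (at x) \<and> d > 0" using \<Phi>_deriv \<Phi>'_pos by blast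
  qed
  \<comment> \<open>Strictness comes from \<open>W\<close>: a failure would give
    \<open>W T' \<le> W T\<close> by \<open>\<Phi>_mono\<close>.\<close>
  have \<phi>_less: "\<phi> T < \<phi> T'" if "T1 \<le> T" "T < T'" for T T'
  proof (rule ccontr)
    assume "\<not> \<phi> T < \<phi> T'"
    then have "\<Phi> (\<phi> T') \<le> \<Phi> (\<phi> T)" using T1(2)[of T'] that by (intro \<Phi>_mono) auto
    then have "W T' \<le> W T" using T1(2)[of T] T1(2)[of T'] that by simp
    then show False using W_less[of T T'] T1(1) that by simp
  qed
  have \<phi>_S: "\<phi> T \<in> S" if "T > T1" for T
    using \<phi>_less[of T1 T] that by (simp add: S_def y1_def)
  have "inj_on \<Phi> S"
    by (rule linorder_inj_onI) (use \<Phi>_less in fastforce)+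
  then have inv: "the_inv_into S \<Phi> (\<Phi> y) = y" if "y \<in> S" for y
    using that by (rule the_inv_into_f_f)
  \<comment> \<open>Inverse function rule for the inverse of \<open>\<Phi>\<close> composed with
    \<open>W\<close>; half of it is the formula for the weight Z^2 / (2
    \<open>\<Phi>'\<close>).\<close>
  define D where "D = (\<lambda>T. inverse (\<Phi>' (\<phi> T)) * w T)"
  have deriv: "(\<phi> has_real_derivative D T) (at T)" if T: "T > T1" for T
  proof (rule has_field_derivative_transform_within_open[where S = "{T1<..}"])
    have eq: "the_inv_into S \<Phi> (W T) = \<phi> T"  if "T > T1" for T
      using inv[OF \<phi>_S[OF that]] T1(2)[of T] that by simp
    have "(the_inv_into S \<Phi> has_real_derivative inverse (\<Phi>' (\<phi> T))) (at (W T))"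
    proof (rule has_field_derivative_inverse_strong_x[where f = \<Phi> and S = S])
      show "(\<Phi> has_real_derivative \<Phi>' (\<phi> T)) (at (the_inv_into S \<Phi> (W T)))"
        using \<Phi>_deriv[OF \<phi>_S[OF T]] by (simp add: eq[OF T])
    qed (use \<Phi>'_pos[OF \<phi>_S[OF T]] \<Phi>c inv eq[OF T] \<phi>_S[OF T] T1(2)[of T] T in \<open>auto simp: S_def\<close>)
    moreover have "(W has_real_derivative w T) (at T)"
    proof -
      have "(W has_real_derivative w T) (at T within {0..T + 1})"
        unfolding W_def by (rule integral_has_real_derivative) (use T T1(1) wc in auto)
      moreover have "at T within {0..T + 1} = at T"
        using T T1(1) by (intro at_within_interior) auto
      ultimately show ?thesis by simp
    qed
    ultimately show "((\<lambda>T. the_inv_into S \<Phi> (W T)) has_real_derivative D T) (at T)"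
      unfolding D_def by (rule DERIV_chain2)
    show "the_inv_into S \<Phi> (W T) = \<phi> T" if "T \<in> {T1<..}" for T
      using eq that by simp
  qed (use T in auto)
  have \<phi>c: "continuous_on {T1 + 1..} \<phi>"
    by (rule DERIV_continuous_on[OF has_field_derivative_at_within[OF deriv]]) simp
  show ?thesis
  \<comment> \<open>Starting beyond \<open>T1\<close> makes \<open>\<phi>\<close> differentiable
    from both sides even at the endpoint of the closed half-line.\<close>
  proof (rule that[of "T1 + 1" D])
    show "continuous_on {T1 + 1..} D"
      unfolding D_def
    proof (intro continuous_intros wc)
      show "continuous_on {T1 + 1..} (\<lambda>T. \<Phi>' (\<phi> T))"
        by (rule continuous_on_compose2[OF \<Phi>'c \<phi>c]) (use \<phi>_S in auto)
      show "\<forall>T\<in>{T1 + 1..}. \<Phi>' (\<phi> T) \<noteq> 0"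
      proof
        fix T assume "T \<in> {T1 + 1..}"
        then have "T > T1" by simp
        from \<Phi>'_pos[OF \<phi>_S[OF this]] show "\<Phi>' (\<phi> T) \<noteq> 0" by simp
      qed
    qed
    show "strict_mono_on {T1 + 1..} \<phi>"
      using \<phi>_less by (intro strict_mono_onI) auto
    show "filterlim \<phi> at_top at_top"
      unfolding filterlim_at_top
    proof
      fix Y
      \<comment> \<open>The maximum keeps the comparison point in the domain of
        \<open>\<Phi>_mono\<close>; values of \<open>\<phi>\<close> below \<open>Y\<close> would
        keep \<open>W\<close> below \<open>\<Phi> Y'\<close>.\<close>
      define Y' where "Y' = max Y y0"
      obtain T2 where T2: "T2 \<ge> 0" "\<Phi> Y' < W T2" using W_unbounded by blast
      have "\<phi> T \<ge> Y" if T: "T \<ge> max T1 T2" for T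
      proof (rule ccontr)
        assume "\<not> \<phi> T \<ge> Y"
        then have "\<Phi> (\<phi> T) \<le> \<Phi> Y'" using T1(2)[of T] T by (intro \<Phi>_mono) (auto simp: Y'_def)
        moreover have "W T2 \<le> W T" using T T2 by (intro W_le) auto
        ultimately show False using T1(2)[of T] T T2 by simp
      qed
      then show "\<forall>\<^sub>F T in at_top. Y \<le> \<phi> T"
        unfolding eventually_at_top_linorder by blast
    qed
  qed (use deriv in auto)
qed

subsection \<open>Orthogonality\<close>

lemma has_integral_cos_nat_mult:
  "((\<lambda>\<theta>. cos (real k * \<theta>)) has_integral (if k = 0 then pi else 0)) {0..pi}"
proof (cases "k = 0")
  case True
  then show ?thesis using has_integral_const_real[of "1 :: real" 0 pi] by simp
next
  case False
  have "((\<lambda>\<theta>. cos (real k * \<theta>)) has_integral (sin (real k * pi) / real k - sin (real k * 0) / real k)) {0..pi}"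
    by (rule fundamental_theorem_of_calculus)
       (use False in \<open>auto intro!: derivative_eq_intros simp flip: has_real_derivative_iff_has_vector_derivative\<close>)
  then show ?thesis using False by simp
qed

lemma has_integral_sin_mult_sin:
  "((\<lambda>\<theta>. sin (real (m + 1) * \<theta>) * sin (real (n + 1) * \<theta>)) has_integral (if m = n then pi / 2 else 0)) {0..pi}"
proof -
  \<comment> \<open>The distance of \<open>m\<close> and \<open>n\<close> as a natural number;
    cosine is even, so the order does not matter.\<close>
  define d where "d = (if m \<le> n then n - m else m - n)"
  have "((\<lambda>\<theta>. (cos (real d * \<theta>) - cos (real (m + n + 2) * \<theta>)) / 2) has_integral
      ((if d = 0 then pi else 0) - (if m + n + 2 = 0 then pi else 0)) / 2) {0..pi}"
    by (intro has_integral_divide has_integral_diff has_integral_cos_nat_mult)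
  moreover have "(cos (real d * \<theta>) - cos (real (m + n + 2) * \<theta>)) / 2 = sin (real (m + 1) * \<theta>) * sin (real (n + 1) * \<theta>)" for \<theta>
  proof -
    have "cos (real d * \<theta>) = cos (real (m + 1) * \<theta> - real (n + 1) * \<theta>)"
      using cos_minus[of "real (m + 1) * \<theta> - real (n + 1) * \<theta>"]
      by (simp add: d_def of_nat_diff algebra_simps)
    moreover have "real (m + n + 2) * \<theta> = real (m + 1) * \<theta> + real (n + 1) * \<theta>"
      by (simp add: algebra_simps)
    ultimately show ?thesis
      by (simp only: sin_times_sin)
  qed
  ultimately show ?thesis by (simp add: d_def split: if_splits)
qed

lemma chebyshev_U_orthogonal:
  "integral {-1..1} (\<lambda>x. poly (chebyshev_U m) x * poly (chebyshev_U n) x * sqrt (1 - x\<^sup>2))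
     = (if m = n then pi / 2 else 0)"
proof -
  let ?f = "\<lambda>x. poly (chebyshev_U m) x * poly (chebyshev_U n) x * sqrt (1 - x\<^sup>2)"
  \<comment> \<open>Substitution x = cos \<theta>, which is decreasing: the first integral on the
    right runs over the empty interval \<open>{1..-1}\<close> and is 0, hence the sign change
    afterwards.\<close>
  have "((\<lambda>\<theta>. - sin \<theta> *\<^sub>R ?f (cos \<theta>)) has_integral (integral {cos 0..cos pi} ?f - integral {cos pi..cos 0} ?f)) {0..pi}"
    by (rule has_integral_substitution_general[where c = "-1" and d = 1 and s = "{}"])
       (auto intro!: continuous_intros derivative_eq_intros)
  then have int: "((\<lambda>\<theta>. - (- sin \<theta> *\<^sub>R ?f (cos \<theta>))) has_integral - (- integral {-1..1} ?f)) {0..pi}"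
    by (intro has_integral_neg) simp
  have eq: "- (- sin \<theta> *\<^sub>R ?f (cos \<theta>)) = sin (real (m + 1) * \<theta>) * sin (real (n + 1) * \<theta>)"
    if \<theta>: "\<theta> \<in> {0..pi}" for \<theta>
  proof (cases "sin \<theta> = 0")
    case True
    then have "\<theta> = 0 \<or> \<theta> = pi" using \<theta> sin_gt_zero[of \<theta>] by force
    then have "sin (real (m + 1) * \<theta>) = 0" using sin_npi[of "m + 1"] by (elim disjE) auto
    then show ?thesis using True by simp
  next
    case False
    have "sqrt (1 - (cos \<theta>)\<^sup>2) = sin \<theta>"
      using \<theta> sin_ge_zero[of \<theta>] by (simp flip: sin_squared_eq)
    then show ?thesis using False by (simp add: poly_chebyshev_U_cos)
  qed
  have "((\<lambda>\<theta>. sin (real (m + 1) * \<theta>) * sin (real (n + 1) * \<theta>)) has_integral - (- integral {-1..1} ?f)) {0..pi}"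
    by (rule has_integral_eq[OF eq int])
  from has_integral_unique[OF this has_integral_sin_mult_sin[of m n]] show ?thesis by simp
qed

text \<open>The ladder is controlled only for large arguments, so its inverse is that of the
  restriction to \<open>{t0..}\<close>; the first conjuncts ensure that this inverse exists from
  \<open>T0\<close> on. The weight is \<open>deriv \<phi>1\<close>, and \<open>has_integral\<close>
  asserts integrability along with the value. Both thresholds are chosen before \<open>T\<close>,
  \<open>m\<close>, \<open>n\<close>.\<close>

theorem corollary6:
  fixes y0 :: real and \<mu> \<phi> \<phi>1 :: "real \<Rightarrow> real"
  assumes "admissible_mu y0 \<mu>"
    and "jacobs_ladder y0 \<mu> \<phi>"
    and "\<phi>1 = (\<lambda>t. \<phi> t / 2)"
  shows "\<exists>t0 T0. \<phi>1 C1_differentiable_on {t0..} \<and> strict_mono_on {t0..} \<phi>1 \<and>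
    filterlim \<phi>1 at_top at_top \<and> \<phi>1 t0 \<le> T0 \<and>
    (\<forall>T\<ge>T0. \<forall>m n :: nat.
       (m \<noteq> n \<longrightarrow>
         ((\<lambda>t. poly (chebyshev_U m) (\<phi>1 t - T - 1) * poly (chebyshev_U n) (\<phi>1 t - T - 1) *
               sqrt (1 - (\<phi>1 t - T - 1)\<^sup>2) * deriv \<phi>1 t) has_integral 0)
           {the_inv_into {t0..} \<phi>1 T .. the_inv_into {t0..} \<phi>1 (T + 2)}) \<and>
       ((\<lambda>t. (poly (chebyshev_U n) (\<phi>1 t - T - 1))\<^sup>2 *
             sqrt (1 - (\<phi>1 t - T - 1)\<^sup>2) * deriv \<phi>1 t) has_integral (pi / 2))
         {the_inv_into {t0..} \<phi>1 T .. the_inv_into {t0..} \<phi>1 (T + 2)})"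
proof -
  obtain t0 D where D: "\<And>t. t \<ge> t0 \<Longrightarrow> (\<phi> has_real_derivative D t) (at t)" "continuous_on {t0..} D"
    and mono: "strict_mono_on {t0..} \<phi>" and lim: "filterlim \<phi> at_top at_top"
    using jacobs_ladder_C1_strict_mono[OF assms(1,2)] by blast
  have D1: "(\<phi>1 has_real_derivative D t / 2) (at t)" if "t \<ge> t0" for t
    unfolding assms(3) by (intro DERIV_cdivide D that)
  have C1: "\<phi>1 C1_differentiable_on {t0..}"
    unfolding C1_differentiable_on_def
    by (rule exI[of _ "\<lambda>t. D t / 2"])
       (use D1 D(2) in \<open>auto intro!: continuous_intros simp flip: has_real_derivative_iff_has_vector_derivative\<close>)
  have mono1: "strict_mono_on {t0..} \<phi>1"
    using mono by (auto simp: strict_mono_on_def assms(3))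
  have lim1: "filterlim \<phi>1 at_top at_top"
    using filterlim_tendsto_pos_mult_at_top[OF tendsto_const[of "1 / 2"] _ lim] by (simp add: assms(3))
  have inj: "inj_on \<phi>1 {t0..}" using mono1 by (rule strict_mono_on_imp_inj_on)
  have cont: "continuous_on {t0..} \<phi>1"
    by (rule DERIV_continuous_on) (use D1 in \<open>auto intro: has_field_derivative_at_within\<close>)
  have surj: "y \<in> \<phi>1 ` {t0..}" if "y \<ge> \<phi>1 t0" for y
  proof -
    have "\<forall>\<^sub>F t in at_top. y \<le> \<phi>1 t \<and> t0 \<le> t"
      using lim1 eventually_ge_at_top[of t0] by (auto simp: filterlim_at_top intro: eventually_conj)
    then obtain b where "y \<le> \<phi>1 b" "t0 \<le> b" by (auto simp: eventually_at_top_linorder)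
    with IVT'[of \<phi>1 t0 y b] that continuous_on_subset[OF cont, of "{t0..b}"]
    show ?thesis by auto
  qed
  have main: "((\<lambda>t. poly (chebyshev_U m) (\<phi>1 t - T - 1) * poly (chebyshev_U n) (\<phi>1 t - T - 1) *
        sqrt (1 - (\<phi>1 t - T - 1)\<^sup>2) * deriv \<phi>1 t) has_integral (if m = n then pi / 2 else 0))
      {the_inv_into {t0..} \<phi>1 T .. the_inv_into {t0..} \<phi>1 (T + 2)}"
    if T: "T \<ge> \<phi>1 t0" for T m n
  proof -
    define a b where "a = the_inv_into {t0..} \<phi>1 T" and "b = the_inv_into {t0..} \<phi>1 (T + 2)"
    have a: "a \<ge> t0" "\<phi>1 a = T"
      using the_inv_into_into[OF inj surj[OF T] order_refl] f_the_inv_into_f[OF inj surj[OF T]]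
      by (auto simp: a_def)
    have T2: "T + 2 \<ge> \<phi>1 t0" using T by simp
    have b: "b \<ge> t0" "\<phi>1 b = T + 2"
      using the_inv_into_into[OF inj surj[OF T2] order_refl] f_the_inv_into_f[OF inj surj[OF T2]]
      by (auto simp: b_def)
    have ab: "a \<le> b"
    proof (rule ccontr)
      assume "\<not> a \<le> b"
      then have "\<phi>1 b < \<phi>1 a" using a b by (intro strict_mono_onD[OF mono1]) auto
      then show False using a b by simp
    qed
    have mono_le: "\<phi>1 s \<le> \<phi>1 t" if "t0 \<le> s" "s \<le> t" for s t
      using strict_mono_onD[OF mono1, of s t] that by (cases "s = t") auto
    let ?f = "\<lambda>x. poly (chebyshev_U m) x * poly (chebyshev_U n) x * sqrt (1 - x\<^sup>2)"
    let ?g = "\<lambda>t. \<phi>1 t - T - 1"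
    have "((\<lambda>t. (D t / 2) *\<^sub>R ?f (?g t)) has_integral (integral {?g a..?g b} ?f)) {a..b}"
    \<comment> \<open>The endpoints \<open>a\<close> and \<open>b\<close> are the preimages of T and
      T + 2, so \<open>?g\<close> maps them to -1 and 1.\<close>
    proof (rule has_integral_substitution[where c = "-1" and d = 1])
      show "?g ` {a..b} \<subseteq> {-1..1}"
      proof
        fix x assume "x \<in> ?g ` {a..b}"
        then obtain t where t: "t \<in> {a..b}" "x = ?g t" by blast
        then have "T \<le> \<phi>1 t" "\<phi>1 t \<le> T + 2"
          using mono_le[of a t] mono_le[of t b] a(1) unfolding a(2) b(2) by auto
        then show "x \<in> {-1..1}" using t(2) by simp
      qed
      fix t assume "t \<in> {a..b}"
      then have "(\<phi>1 has_real_derivative D t / 2) (at t within {a..b})"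
        using D1[of t] a by (auto intro: has_field_derivative_at_within)
      then show "(?g has_real_derivative D t / 2) (at t within {a..b})"
        by (auto intro!: derivative_eq_intros)
    qed (use a b ab in \<open>auto intro!: continuous_intros\<close>)
    then have int: "((\<lambda>t. (D t / 2) *\<^sub>R ?f (?g t)) has_integral (if m = n then pi / 2 else 0)) {a..b}"
      using a b chebyshev_U_orthogonal[of m n] by simp
    \<comment> \<open>Valid also at the endpoints of \<open>[a, b]\<close>, as \<open>D1\<close> is
      a two-sided derivative from \<open>t0\<close> on.\<close>
    have eq: "(D t / 2) *\<^sub>R ?f (?g t) = ?f (?g t) * deriv \<phi>1 t" if "t \<in> {a..b}" for t
      using DERIV_imp_deriv[OF D1[of t]] that a by simp
    show ?thesis using has_integral_eq[OF eq int] by (simp add: a_def b_def)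
  qed
  show ?thesis
  proof (rule exI[of _ t0], rule exI[of _ "\<phi>1 t0"], intro conjI allI impI C1 mono1 lim1 order_refl)
    fix T :: real and m n :: nat assume T: "\<phi>1 t0 \<le> T" and "m \<noteq> n"
    with main[OF T, of m n]
    show "((\<lambda>t. poly (chebyshev_U m) (\<phi>1 t - T - 1) * poly (chebyshev_U n) (\<phi>1 t - T - 1) *
               sqrt (1 - (\<phi>1 t - T - 1)\<^sup>2) * deriv \<phi>1 t) has_integral 0)
           {the_inv_into {t0..} \<phi>1 T .. the_inv_into {t0..} \<phi>1 (T + 2)}" by simp
  next
    fix T :: real and n :: nat assume T: "\<phi>1 t0 \<le> T"
    from main[OF T, of n n]
    show "((\<lambda>t. (poly (chebyshev_U n) (\<phi>1 t - T - 1))\<^sup>2 *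
             sqrt (1 - (\<phi>1 t - T - 1)\<^sup>2) * deriv \<phi>1 t) has_integral (pi / 2))
         {the_inv_into {t0..} \<phi>1 T .. the_inv_into {t0..} \<phi>1 (T + 2)}"
      by (simp add: power2_eq_square)
  qed
qed

end
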